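(* Let $\Gamma,\Gamma'$ be countable dense additive subgroups of $\mathbb{R}$, each containing $1$. Then the following are equivalent: \begin{itemize} \item $IE(\Gamma)\cong IE(\Gamma')$ as abstract groups; \item $\Gamma=\Gamma'$ as subsets of $\mathbb{R}$. \end{itemize}
   Context: For a countable dense additive subgroup $\Gamma\subset\mathbb{R}$ with $1\in\Gamma$, $IE(\Gamma)$ is the group, under composition, of all bijections $f:[0,1]\to[0,1]$ with $f(0)=0$ for which there exist $0=x_1<x_2<\dots<x_n=1$ in $\Gamma$ and $c_1,\dots,c_{n-1}\in\Gamma$ with $f(t)=t+c_i$ for all $t\in(x_i,x_{i+1}]$. *)

theory Defs
  imports "HOL-Analysis.Analysis" "HOL-Algebra.Bij"
begin

definition real_add_group :: "real monoid"
  where "real_add_group = \<lparr>carrier = UNIV, mult = (+), one = 0\<rparr>"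

lemma group_real_add_group: "group real_add_group"
  unfolding real_add_group_def
  by (rule groupI) (auto intro: exI[of _ "- x" for x])

lemma subgroup_real_add_group_iff:
  "subgroup G real_add_group \<longleftrightarrow>
     0 \<in> G \<and> (\<forall>x\<in>G. \<forall>y\<in>G. x + y \<in> G) \<and> (\<forall>x\<in>G. - x \<in> G)"
proof -
  interpret group real_add_group
    by (rule group_real_add_group)
  have "inv\<^bsub>real_add_group\<^esub> x = - x" for x
    by (rule inv_equality) (auto simp: real_add_group_def)
  then show ?thesis
    by (auto simp: subgroup_def real_add_group_def)
qed

text \<open>
  The interval exchanges of \<open>[0, 1]\<close> over \<open>\<Gamma>\<close>. As in \<^const>\<open>Bij\<close>, a self-map of \<open>[0, 1]\<close> is
  represented by a function that is \<^const>\<open>undefined\<close> outside \<open>[0, 1]\<close>, so that equality in the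
  carrier is equality of maps on \<open>[0, 1]\<close>. The intervals \<open>(x\<^sub>i, x\<^sub>i\<^sub>+\<^sub>1]\<close> miss \<open>0\<close>; the condition
  \<open>f 0 = 0\<close> fixes the value there. Only \<open>x 1, \<dots>, x n\<close> and \<open>c 1, \<dots>, c (n - 1)\<close> are constrained.
\<close>

definition IE_carrier :: "real set \<Rightarrow> (real \<Rightarrow> real) set"
  where "IE_carrier \<Gamma> = {f \<in> Bij {0..1}. f 0 = 0 \<and>
    (\<exists>(n::nat) (x::nat \<Rightarrow> real) (c::nat \<Rightarrow> real).
       2 \<le> n \<and> x 1 = 0 \<and> x n = 1 \<and>
       (\<forall>i\<in>{1..n}. x i \<in> \<Gamma>) \<and>
       (\<forall>i\<in>{1..<n}. x i < x (Suc i)) \<and>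
       (\<forall>i\<in>{1..<n}. c i \<in> \<Gamma>) \<and>
       (\<forall>i\<in>{1..<n}. \<forall>t\<in>{x i<..x (Suc i)}. f t = t + c i))}"

definition IE :: "real set \<Rightarrow> (real \<Rightarrow> real) monoid"
  where "IE \<Gamma> = (BijGroup {0..1})\<lparr>carrier := IE_carrier \<Gamma>\<rparr>"

end

theory Submission
  imports Defs
begin

text \<open>
  The support of an interval exchange is a finite union of half-open intervals with endpoints in
  \<open>\<Gamma>\<close>, and inclusion of supports can be read off the abstract group. For an involution \<open>p\<close>, let \<open>U\<close>
  be the set of all \<open>u\<close> with \<open>u\<^sup>2 = 1\<close> that commute with \<open>p\<close> and with all their conjugates by elements of the
  centraliser of \<open>p\<close>. These are supported in the support of \<open>p\<close>, and squares of elements of the centraliser of \<open>U\<close>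
  act trivially there, so that the centraliser of these squares is exactly the
  group of elements supported in the support of \<open>p\<close> (this argument is due to Fremlin). Its centraliser
  consists of the elements with support disjoint from that of \<open>p\<close>, and \<open>supp f \<subseteq> supp g\<close> holds iff every
  involution disjoint from \<open>g\<close> is disjoint from \<open>f\<close>.

  An isomorphism \<open>\<phi>\<close> therefore carries supports to supports, preserving unions and disjointness, and
  \<open>f \<mapsto> |supp (\<phi> f)|\<close> induces a normalised, finitely additive, translation invariant mass on
  intervals with endpoints in \<open>\<Gamma>\<close>. Such a mass is the length; as supports of elements of
  \<open>IE \<Gamma>'\<close> have measure in \<open>\<Gamma>'\<close>, every \<open>t \<in> \<Gamma> \<inter> [0, 1]\<close> lies in \<open>\<Gamma>'\<close>.
\<close>

section \<open>Centralisers in abstract groups\<close>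

definition centraliser :: "('a, 'b) monoid_scheme \<Rightarrow> 'a set \<Rightarrow> 'a set"
  where "centraliser G S = {x \<in> carrier G. \<forall>s\<in>S. x \<otimes>\<^bsub>G\<^esub> s = s \<otimes>\<^bsub>G\<^esub> x}"

definition twists :: "('a, 'b) monoid_scheme \<Rightarrow> 'a \<Rightarrow> 'a set"
  where "twists G p = {u \<in> centraliser G {p}. u \<otimes>\<^bsub>G\<^esub> u = \<one>\<^bsub>G\<^esub> \<and>
    (\<forall>v\<in>centraliser G {p}. u \<in> centraliser G {v \<otimes>\<^bsub>G\<^esub> u \<otimes>\<^bsub>G\<^esub> inv\<^bsub>G\<^esub> v})}"

definition rigid :: "('a, 'b) monoid_scheme \<Rightarrow> 'a \<Rightarrow> 'a set"
  where "rigid G p = centraliser G ((\<lambda>v. v \<otimes>\<^bsub>G\<^esub> v) ` centraliser G (twists G p))"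

lemma centraliser_iso:
  assumes "\<phi> \<in> iso G H" "S \<subseteq> carrier G" "x \<in> carrier G" "group G" "group H"
  shows "\<phi> x \<in> centraliser H (\<phi> ` S) \<longleftrightarrow> x \<in> centraliser G S"
proof -
  interpret G: group G by fact
  have hom: "\<And>x y. x \<in> carrier G \<Longrightarrow> y \<in> carrier G \<Longrightarrow> \<phi> (x \<otimes>\<^bsub>G\<^esub> y) = \<phi> x \<otimes>\<^bsub>H\<^esub> \<phi> y"
    and inj: "inj_on \<phi> (carrier G)" and in_H: "\<phi> x \<in> carrier H"
    using assms by (auto simp: iso_iff hom_def)
  have "\<phi> x \<otimes>\<^bsub>H\<^esub> \<phi> s = \<phi> s \<otimes>\<^bsub>H\<^esub> \<phi> x \<longleftrightarrow> x \<otimes>\<^bsub>G\<^esub> s = s \<otimes>\<^bsub>G\<^esub> x" if "s \<in> S" for s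
  proof -
    have "s \<in> carrier G" using that assms by blast
    then show ?thesis using assms(3) by (simp flip: hom add: inj_on_eq_iff[OF inj])
  qed
  then show ?thesis using assms(3) in_H by (simp add: centraliser_def)
qed

lemma iso_image_eqI:
  assumes "\<phi> \<in> iso G H" "A \<subseteq> carrier G" "B \<subseteq> carrier H"
    and "\<And>x. x \<in> carrier G \<Longrightarrow> \<phi> x \<in> B \<longleftrightarrow> x \<in> A"
  shows "\<phi> ` A = B"
proof -
  have \<phi>: "\<phi> ` carrier G = carrier H" using assms(1) by (auto simp: iso_iff)
  show ?thesis
  proof (intro equalityI subsetI)
    fix y assume "y \<in> B"
    moreover from this obtain x where "x \<in> carrier G" "y = \<phi> x" using assms(3) \<phi> by blast
    ultimately show "y \<in> \<phi> ` A" using assms(4) by simp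
  qed (use assms(2,4) in auto)
qed

lemma centraliser_subset: "centraliser G S \<subseteq> carrier G"
  by (auto simp: centraliser_def)

text \<open>Every clause in \<open>twists\<close> is phrased in group operations alone, so it pulls
  back along an isomorphism; only the range of the conjugators needs surjectivity.\<close>

lemma twists_iso:
  assumes \<phi>: "\<phi> \<in> iso G H" and p: "p \<in> carrier G" and G: "group G" and H: "group H"
  shows "\<phi> ` twists G p = twists H (\<phi> p)"
proof (rule iso_image_eqI[OF \<phi>])
  interpret G: group G by fact
  interpret H: group H by fact
  interpret \<phi>: group_hom G H \<phi>
    using \<phi> by unfold_locales (simp add: iso_def)
  show "twists G p \<subseteq> carrier G" "twists H (\<phi> p) \<subseteq> carrier H"
    by (auto simp: twists_def centraliser_def)
  fix u assume u: "u \<in> carrier G"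
  have inj: "inj_on \<phi> (carrier G)" using \<phi> by (simp add: iso_iff)
  have c: "\<phi> x \<in> centraliser H {\<phi> y} \<longleftrightarrow> x \<in> centraliser G {y}" if "x \<in> carrier G" "y \<in> carrier G" for x y
    using centraliser_iso[OF \<phi>, of "{y}" x] that G H by simp
  \<comment> \<open>The conjugators over \<open>H\<close> are exactly the images of those over
    \<open>G\<close>, so the quantifier over \<open>v\<close> can be taken over
    \<open>G\<close>.\<close>
  have cp: "centraliser H {\<phi> p} = \<phi> ` centraliser G {p}"
    by (rule iso_image_eqI[OF \<phi>, symmetric]) (simp_all add: centraliser_subset c p)
  have "\<phi> u \<otimes>\<^bsub>H\<^esub> \<phi> u = \<one>\<^bsub>H\<^esub> \<longleftrightarrow> u \<otimes>\<^bsub>G\<^esub> u = \<one>\<^bsub>G\<^esub>"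
    using u inj_on_eq_iff[OF inj, of "u \<otimes>\<^bsub>G\<^esub> u" "\<one>\<^bsub>G\<^esub>"] by simp
  moreover have "\<phi> u \<in> centraliser H {\<phi> v \<otimes>\<^bsub>H\<^esub> \<phi> u \<otimes>\<^bsub>H\<^esub> inv\<^bsub>H\<^esub> \<phi> v} \<longleftrightarrow>
      u \<in> centraliser G {v \<otimes>\<^bsub>G\<^esub> u \<otimes>\<^bsub>G\<^esub> inv\<^bsub>G\<^esub> v}" if "v \<in> centraliser G {p}" for v
    using c[OF u, of "v \<otimes>\<^bsub>G\<^esub> u \<otimes>\<^bsub>G\<^esub> inv\<^bsub>G\<^esub> v"] that u centraliser_subset[of G "{p}"] by auto
  ultimately show "\<phi> u \<in> twists H (\<phi> p) \<longleftrightarrow> u \<in> twists G p"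
    using c[OF u p] by (simp add: twists_def cp)
qed

lemma rigid_iso:
  assumes \<phi>: "\<phi> \<in> iso G H" and p: "p \<in> carrier G" and G: "group G" and H: "group H"
  shows "\<phi> ` rigid G p = rigid H (\<phi> p)"
proof -
  interpret G: group G by fact
  interpret H: group H by fact
  have image: "\<phi> ` centraliser G S = centraliser H (\<phi> ` S)" if "S \<subseteq> carrier G" for S
    using centraliser_iso[OF \<phi> that _ G H]
    by (intro iso_image_eqI[OF \<phi>]) (simp_all add: centraliser_subset)
  have "twists G p \<subseteq> carrier G" by (auto simp: twists_def centraliser_def)
  note V = image[OF this, unfolded twists_iso[OF assms]]
  have "(\<lambda>v. v \<otimes>\<^bsub>G\<^esub> v) ` centraliser G (twists G p) \<subseteq> carrier G"
    by (auto simp: centraliser_def)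
  note W = image[OF this]
  have "\<phi> (v \<otimes>\<^bsub>G\<^esub> v) = \<phi> v \<otimes>\<^bsub>H\<^esub> \<phi> v" if "v \<in> centraliser G (twists G p)" for v
    using \<phi> that by (auto simp: iso_iff hom_def centraliser_def)
  then have "\<phi> ` (\<lambda>v. v \<otimes>\<^bsub>G\<^esub> v) ` centraliser G (twists G p) = (\<lambda>v. v \<otimes>\<^bsub>H\<^esub> v) ` \<phi> ` centraliser G (twists G p)"
    by (simp add: image_image)
  then show ?thesis using W V by (simp add: rigid_def)
qed

section \<open>The group of interval exchanges\<close>

text \<open>No closure is taken: this is the exact set of moved points. The point 0, fixed by every
  exchange, is left out, so that supports are unions of half-open pieces.\<close>

definition supp :: "(real \<Rightarrow> real) \<Rightarrow> real set"
  where "supp f = {x \<in> {0<..1}. f x \<noteq> x}"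

lemma supp_subset: "supp f \<subseteq> {0<..1}"
  by (auto simp: supp_def)

lemma half_open_lmeasurable: "{a<..b} \<in> lmeasurable" for a b :: real
  by (rule bounded_set_imp_lmeasurable) (auto intro: bounded_subset[OF bounded_closed_interval[of a b]])

lemma measure_finite_Union_fmeasurable:
  assumes "finite I" "\<And>i. i \<in> I \<Longrightarrow> A i \<in> fmeasurable M" "disjoint_family_on A I"
  shows "measure M (\<Union>i\<in>I. A i) = (\<Sum>i\<in>I. measure M (A i))"
proof (rule measure_finite_Union[OF assms(1) _ assms(3)])
  show "A ` I \<subseteq> sets M" using assms(2) by (auto dest: fmeasurableD)
  show "emeasure M (A i) \<noteq> \<infinity>" if "i \<in> I" for i using fmeasurableD2[OF assms(2)[OF that]] by simp
qed

section \<open>Arithmetic and density of the subgroup\<close>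

locale dense_subgroup =
  fixes \<Gamma> :: "real set"
  assumes subgroup: "subgroup \<Gamma> real_add_group"
    and dense: "closure \<Gamma> = UNIV"
    and one: "1 \<in> \<Gamma>"
begin

lemma zero: "0 \<in> \<Gamma>" and add: "a \<in> \<Gamma> \<Longrightarrow> b \<in> \<Gamma> \<Longrightarrow> a + b \<in> \<Gamma>" and minus: "a \<in> \<Gamma> \<Longrightarrow> - a \<in> \<Gamma>"
  using subgroup by (auto simp: subgroup_real_add_group_iff)

lemma diff: "a \<in> \<Gamma> \<Longrightarrow> b \<in> \<Gamma> \<Longrightarrow> a - b \<in> \<Gamma>"
  using add[OF _ minus] by fastforce

lemma min_max: "a \<in> \<Gamma> \<Longrightarrow> b \<in> \<Gamma> \<Longrightarrow> min a b \<in> \<Gamma>" "a \<in> \<Gamma> \<Longrightarrow> b \<in> \<Gamma> \<Longrightarrow> max a b \<in> \<Gamma>"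
  by (auto simp: min_def max_def)

lemma sum_mem: "(\<And>i. i \<in> I \<Longrightarrow> f i \<in> \<Gamma>) \<Longrightarrow> sum f I \<in> \<Gamma>"
  by (induction I rule: infinite_finite_induct) (auto simp: zero add)

lemma of_nat_mult: "a \<in> \<Gamma> \<Longrightarrow> of_nat n * a \<in> \<Gamma>"
  by (induction n) (auto simp: zero add algebra_simps)

lemma of_int_mem: "of_int k \<in> \<Gamma>"
proof (cases "k \<ge> 0")
  case True
  then show ?thesis
    using of_nat_mult[OF one, of "nat k"] by simp
next
  case False
  then show ?thesis
    using minus[OF of_nat_mult[OF one, of "nat (- k)"]] by simp
qed

lemma between:
  assumes "a < b"
  obtains c where "c \<in> \<Gamma>" "a < c" "c < b"
proof -
  have "(a + b) / 2 \<in> closure \<Gamma>" by (simp add: dense)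
  from closure_approachableD[OF this, of "(b - a) / 2"] assms
  obtain y where "y \<in> \<Gamma>" "\<bar>(a + b) / 2 - y\<bar> < (b - a) / 2"
    by (auto simp: dist_real_def)
  then have "a < y" "y < b" by (auto simp: abs_less_iff field_simps)
  with \<open>y \<in> \<Gamma>\<close> show ?thesis by (rule that)
qed

lemma shrink:
  assumes "a \<in> \<Gamma>" "b \<in> \<Gamma>" "x \<in> {a<..b}" "0 < \<epsilon>"
  obtains p q where "p \<in> \<Gamma>" "q \<in> \<Gamma>" "a \<le> p" "p < x" "x \<le> q" "q \<le> b" "q - p < \<epsilon>"
proof -
  obtain p where p: "p \<in> \<Gamma>" "max a (x - \<epsilon> / 2) < p" "p < x"
    using between[of "max a (x - \<epsilon> / 2)" x] assms by auto
  obtain q where q: "q \<in> \<Gamma>" "x \<le> q" "q \<le> b" "q < x + \<epsilon> / 2"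
  \<comment> \<open>At the right end there is no room beyond \<open>x\<close> inside the half-open
    interval, so \<open>b\<close> itself serves as \<open>q\<close>.\<close>
  proof (cases "x = b")
    case True
    then show ?thesis using assms that[of b] by auto
  next
    case False
    then obtain q where "q \<in> \<Gamma>" "x < q" "q < min b (x + \<epsilon> / 2)"
      using between[of x "min b (x + \<epsilon> / 2)"] assms by auto
    then show ?thesis using that[of q] by auto
  qed
  show ?thesis
    by (rule that[of p q]) (use p q in auto)
qed

section \<open>Piecewise translations and their stability\<close>

text \<open>A finite cover replaces the ordered subdivision: pieces may overlap, be empty or stick
  out of (0, 1]. This makes stability under composition and inversion a matter of forming new
  triples; \<open>steps\<close> recovers a subdivision.\<close>

definition piecewise :: "(real \<Rightarrow> real) \<Rightarrow> bool"
  where "piecewise f \<longleftrightarrow> (\<exists>T. finite T \<and> T \<subseteq> \<Gamma> \<times> \<Gamma> \<times> \<Gamma> \<and>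
    {0<..1} \<subseteq> (\<Union>(a, b, c)\<in>T. {a<..b}) \<and>
    (\<forall>(a, b, c)\<in>T. \<forall>t\<in>{a<..b} \<inter> {0<..1}. f t = t + c))"

lemma piecewise_cong: "(\<And>t. t \<in> {0<..1} \<Longrightarrow> f t = g t) \<Longrightarrow> piecewise f \<longleftrightarrow> piecewise g"
  unfolding piecewise_def by simp

lemma piecewise_local:
  assumes "piecewise f" "x \<in> {0<..1}"
  obtains a b c where "a \<in> \<Gamma>" "b \<in> \<Gamma>" "c \<in> \<Gamma>" "0 \<le> a" "b \<le> 1" "x \<in> {a<..b}"
    "\<forall>t\<in>{a<..b}. f t = t + c"
proof -
  obtain T where T: "T \<subseteq> \<Gamma> \<times> \<Gamma> \<times> \<Gamma>" "{0<..1} \<subseteq> (\<Union>(a, b, c)\<in>T. {a<..b})"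
    "\<forall>(a, b, c)\<in>T. \<forall>t\<in>{a<..b} \<inter> {0<..1}. f t = t + c"
    using assms unfolding piecewise_def by auto
  then obtain a b c where abc: "(a, b, c) \<in> T" "x \<in> {a<..b}"
    using assms(2) by blast
  then have c: "\<And>t. t \<in> {a<..b} \<inter> {0<..1} \<Longrightarrow> f t = t + c"
    using T(3) by blast
  have "a \<in> \<Gamma>" "b \<in> \<Gamma>" "c \<in> \<Gamma>" using abc T(1) by auto
  then show ?thesis
    using abc assms(2)
    by (intro that[of "max a 0" "min b 1" c]) (auto simp: min_max zero one intro!: c)
qed

lemma piecewise_comp:
  assumes "piecewise f" "piecewise g" "f ` {0<..1} \<subseteq> {0<..1}"
  shows "piecewise (\<lambda>t. g (f t))"
proof -
  obtain T where T: "finite T" "T \<subseteq> \<Gamma> \<times> \<Gamma> \<times> \<Gamma>" "{0<..1} \<subseteq> (\<Union>(a, b, c)\<in>T. {a<..b})"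
    "\<forall>(a, b, c)\<in>T. \<forall>t\<in>{a<..b} \<inter> {0<..1}. f t = t + c"
    using assms(1) unfolding piecewise_def by auto
  obtain S where S: "finite S" "S \<subseteq> \<Gamma> \<times> \<Gamma> \<times> \<Gamma>" "{0<..1} \<subseteq> (\<Union>(a, b, c)\<in>S. {a<..b})"
    "\<forall>(a, b, c)\<in>S. \<forall>t\<in>{a<..b} \<inter> {0<..1}. g t = t + c"
    using assms(2) unfolding piecewise_def by auto
  \<comment> \<open>On a piece where \<open>f\<close> adds \<open>c\<close>, the preimage of (a',
    b'] is (a' - c, b' - c]. Intersecting it with (a, b] gives a piece of the composite, and the
    offsets add.\<close>
  define R where "R = (\<lambda>((a, b, c), (a', b', c')). (max a (a' - c), min b (b' - c), c + c')) ` (T \<times> S)"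
  have "finite R" using S T by (simp add: R_def)
  moreover have "R \<subseteq> \<Gamma> \<times> \<Gamma> \<times> \<Gamma>"
    using S(2) T(2) by (auto simp: R_def intro!: min_max diff add)
  moreover have "{0<..1} \<subseteq> (\<Union>(a, b, c)\<in>R. {a<..b})"
  proof
    fix t :: real assume t: "t \<in> {0<..1}"
    then obtain a b c where abc: "(a, b, c) \<in> T" "t \<in> {a<..b}" using T(3) by blast
    with T(4) t have ft: "f t = t + c" by blast
    have "f t \<in> {0<..1}" using assms(3) t by blast
    then obtain a' b' c' where abc': "(a', b', c') \<in> S" "f t \<in> {a'<..b'}" using S(3) by blast
    have "(max a (a' - c), min b (b' - c), c + c') \<in> R"
      using abc abc' by (force simp: R_def)
    moreover have "t \<in> {max a (a' - c)<..min b (b' - c)}"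
      using abc(2) abc'(2) ft by auto
    ultimately show "t \<in> (\<Union>(a, b, c)\<in>R. {a<..b})" by blast
  qed
  moreover have "\<forall>(a, b, c)\<in>R. \<forall>t\<in>{a<..b} \<inter> {0<..1}. g (f t) = t + c"
  proof clarify
    fix u v w t assume "(u, v, w) \<in> R" and t: "t \<in> {u<..v}" "t \<in> {0<..1}"
    then obtain a b c a' b' c' where abc: "(a, b, c) \<in> T" "(a', b', c') \<in> S"
      and eq: "u = max a (a' - c)" "v = min b (b' - c)" "w = c + c'"
      by (auto simp: R_def)
    have "t \<in> {a<..b}" using t eq by auto
    then have ft: "f t = t + c" using T(4) t abc by blast
    have "f t \<in> {0<..1}" using t assms(3) by blast
    moreover have "f t \<in> {a'<..b'}" using t eq ft by auto
    ultimately have "g (f t) = f t + c'" using S(4) abc by blast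
    then show "g (f t) = t + w" using ft eq by simp
  qed
  ultimately show ?thesis unfolding piecewise_def by blast
qed

lemma piecewise_inverse:
  assumes "piecewise f" "f ` {0<..1} \<subseteq> {0<..1}" "\<And>t. t \<in> {0<..1} \<Longrightarrow> g t \<in> {0<..1} \<and> f (g t) = t"
    "\<And>t. t \<in> {0<..1} \<Longrightarrow> g (f t) = t"
  shows "piecewise g"
proof -
  obtain T where T: "finite T" "T \<subseteq> \<Gamma> \<times> \<Gamma> \<times> \<Gamma>" "{0<..1} \<subseteq> (\<Union>(a, b, c)\<in>T. {a<..b})"
    "\<forall>(a, b, c)\<in>T. \<forall>t\<in>{a<..b} \<inter> {0<..1}. f t = t + c"
    using assms(1) unfolding piecewise_def by auto
  \<comment> \<open>The formula for \<open>f\<close> is known only inside (0, 1], so each piece is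
    clipped to (0, 1] before it is shifted to its image.\<close>
  define R where "R = (\<lambda>(a, b, c). (max a 0 + c, min b 1 + c, - c)) ` T"
  have "finite R" using T by (simp add: R_def)
  moreover have "R \<subseteq> \<Gamma> \<times> \<Gamma> \<times> \<Gamma>"
    using T(2) by (auto simp: R_def intro!: min_max diff add zero one minus)
  moreover have "{0<..1} \<subseteq> (\<Union>(a, b, c)\<in>R. {a<..b})"
  proof
    fix s :: real assume s: "s \<in> {0<..1}"
    define t where "t = g s"
    have t: "t \<in> {0<..1}" "f t = s" using assms(3)[OF s] by (auto simp: t_def)
    then obtain a b c where abc: "(a, b, c) \<in> T" "t \<in> {a<..b}" using T(3) by blast
    then have "f t = t + c" using T(4) t by blast
    then have "s \<in> {max a 0 + c<..min b 1 + c}" using t abc by auto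
    moreover have "(max a 0 + c, min b 1 + c, - c) \<in> R" using abc by (force simp: R_def)
    ultimately show "s \<in> (\<Union>(a, b, c)\<in>R. {a<..b})" by blast
  qed
  moreover have "\<forall>(a, b, c)\<in>R. \<forall>t\<in>{a<..b} \<inter> {0<..1}. g t = t + c"
  proof clarify
    fix u v w s assume "(u, v, w) \<in> R" and s: "s \<in> {u<..v}" "s \<in> {0<..1}"
    then obtain a b c where abc: "(a, b, c) \<in> T"
      and eq: "u = max a 0 + c" "v = min b 1 + c" "w = - c"
      by (auto simp: R_def)
    define t where "t = s - c"
    have t: "t \<in> {a<..b}" "t \<in> {0<..1}" using s eq by (auto simp: t_def)
    then have "f t = s" using T(4) abc by (fastforce simp: t_def)
    then show "g s = s + w" using assms(4)[OF t(2)] eq by (simp add: t_def)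
  qed
  ultimately show ?thesis unfolding piecewise_def by blast
qed

lemma in_step:
  fixes x :: "nat \<Rightarrow> real"
  assumes "1 \<le> n" "x 1 < t" "t \<le> x n"
  obtains i where "i \<in> {1..<n}" "x i < t" "t \<le> x (Suc i)"
  using assms
proof (induction n arbitrary: thesis rule: nat_induct_at_least)
  case base
  then show ?case by simp
next
  case (Suc n)
  show ?case
  proof (cases "t \<le> x n")
    case True
    then show ?thesis using Suc.IH Suc.prems by (metis atLeastLessThan_iff less_SucI)
  next
    case False
    then show ?thesis using Suc.prems Suc.hyps by (intro Suc.prems(1)[of n]) auto
  qed
qed

text \<open>Sort 0, 1 and all endpoints in [0, 1]. No endpoint lies strictly between two consecutive
  ones, so a piece that contains the right end of a gap covers the whole gap.\<close>

lemma steps: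
  assumes "piecewise f"
  obtains n :: nat and x c :: "nat \<Rightarrow> real" where "2 \<le> n" "x 1 = 0" "x n = 1"
    "\<And>i. i \<in> {1..n} \<Longrightarrow> x i \<in> \<Gamma>" "\<And>i. i \<in> {1..<n} \<Longrightarrow> x i < x (Suc i)"
    "\<And>i. i \<in> {1..<n} \<Longrightarrow> c i \<in> \<Gamma>" "\<And>i t. i \<in> {1..<n} \<Longrightarrow> t \<in> {x i<..x (Suc i)} \<Longrightarrow> f t = t + c i"
proof -
  obtain T where T: "finite T" "T \<subseteq> \<Gamma> \<times> \<Gamma> \<times> \<Gamma>" "{0<..1} \<subseteq> (\<Union>(a, b, c)\<in>T. {a<..b})"
    "\<forall>(a, b, c)\<in>T. \<forall>t\<in>{a<..b} \<inter> {0<..1}. f t = t + c"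
    using assms unfolding piecewise_def by auto
  define P where "P = {0, 1} \<union> ((fst ` T \<union> (fst \<circ> snd) ` T) \<inter> {0..1})"
  define xs where "xs = sorted_list_of_set P"
  have P: "finite P" "P \<subseteq> \<Gamma> \<inter> {0..1}" "0 \<in> P" "1 \<in> P"
    using T(1,2) by (auto simp: P_def zero one)
  have xs: "set xs = P" "sorted xs" "distinct xs" "length xs = card P"
    using P by (auto simp: xs_def)
  have sorted: "sorted_wrt (<) xs" using xs by (simp add: strict_sorted_iff)
  have card: "2 \<le> card P"
    using card_mono[of P "{0,1}"] P by auto
  \<comment> \<open>Lists are indexed from 0, the points of the subdivision from 1.\<close>
  define x where "x i = xs ! (i - 1)" for i
  have x_mem: "x i \<in> P" if "i \<in> {1..card P}" for i
  proof -
    have "i - 1 < length xs" using that xs(4) by auto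
    then show ?thesis using nth_mem[of "i - 1" xs] xs(1) by (simp add: x_def)
  qed
  have x_less: "x i < x j" if "1 \<le> i" "i < j" "j \<le> card P" for i j
    using that xs(4) sorted_wrt_nth_less[OF sorted, of "i - 1" "j - 1"] by (auto simp: x_def)
  have x_surj: "\<exists>i\<in>{1..card P}. p = x i" if "p \<in> P" for p
  proof -
    have "p \<in> set xs" using that xs(1) by simp
    then obtain k where "k < length xs" "xs ! k = p" unfolding in_set_conv_nth by (elim exE conjE)
    then show ?thesis using xs(4) by (intro bexI[of _ "Suc k"]) (auto simp: x_def)
  qed
  have x_gap: "p \<le> x i \<or> x (Suc i) \<le> p" if p: "p \<in> P" and i: "i \<in> {1..<card P}" for p i
  proof -
    obtain j where j: "j \<in> {1..card P}" "p = x j" using x_surj[OF p] by auto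
    show ?thesis
    proof (cases "j \<le> i")
      case True
      then show ?thesis using x_less[of j i] i j by (cases "j = i") auto
    next
      case False
      then show ?thesis using x_less[of "Suc i" j] i j by (cases "j = Suc i") auto
    qed
  qed
  have x01: "x i \<in> \<Gamma>" "0 \<le> x i" "x i \<le> 1" if "i \<in> {1..card P}" for i
    using x_mem[OF that] P(2) by auto
  have x1: "x 1 = 0"
  proof -
    obtain j where j: "j \<in> {1..card P}" "0 = x j" using x_surj P by metis
    have "x 1 \<ge> 0" using x01[of 1] card by simp
    then show ?thesis using x_less[of 1 j] j by (cases "j = 1") auto
  qed
  have xn: "x (card P) = 1"
  proof -
    obtain j where j: "j \<in> {1..card P}" "1 = x j" using x_surj P by metis
    have "x (card P) \<le> 1" using x01[of "card P"] card by simp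
    then show ?thesis using x_less[of j "card P"] j by (cases "j = card P") auto
  qed
  \<comment> \<open>The offset is read off at the right end, which belongs to the half-open
    gap.\<close>
  define c where "c i = f (x (Suc i)) - x (Suc i)" for i
  have piece: "c i \<in> \<Gamma> \<and> (\<forall>t\<in>{x i<..x (Suc i)}. f t = t + c i)" if i: "i \<in> {1..<card P}" for i
  proof -
    have ii: "0 \<le> x i" "x i < x (Suc i)" "x (Suc i) \<le> 1"
      using x01[of i] x01[of "Suc i"] x_less[of i "Suc i"] i by simp_all
    then have "x (Suc i) \<in> {0<..1}" by simp
    then obtain a b d where abd: "(a, b, d) \<in> T" "x (Suc i) \<in> {a<..b}" using T(3) by blast
    \<comment> \<open>Either \<open>a\<close> is one of the sorted points and cannot fall inside the
      gap, or it lies outside [0, 1] and is then negative, being below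
      \<open>x (Suc i)\<close>.\<close>
    have "a \<le> x i"
    proof (cases "a \<in> {0..1}")
      case True
      then have "a \<in> P" using abd by (force simp: P_def)
      from x_gap[OF this i] show ?thesis using abd by auto
    next
      case False
      then show ?thesis using ii abd by auto
    qed
    then have f: "f t = t + d" if "t \<in> {x i<..x (Suc i)}" for t
    proof -
      have "t \<in> {a<..b} \<inter> {0<..1}" using that abd ii \<open>a \<le> x i\<close> by auto
      then show ?thesis using T(4) abd(1) by blast
    qed
    then have "c i = d" using ii by (simp add: c_def)
    then show ?thesis using f abd T(2) by auto
  qed
  show ?thesis
    by (rule that[of "card P" x c]) (use card x1 xn x01 x_less piece in auto)
qed

section \<open>The group structure and pointwise evaluation\<close>

lemma IE_carrier_iff: "f \<in> IE_carrier \<Gamma> \<longleftrightarrow> f \<in> Bij {0..1} \<and> f 0 = 0 \<and> piecewise f"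
proof (intro iffI conjI)
  assume f: "f \<in> IE_carrier \<Gamma>"
  then show "f \<in> Bij {0..1}" "f 0 = 0" by (auto simp: IE_carrier_def)
  from f obtain n and x c :: "nat \<Rightarrow> real" where x: "2 \<le> n" "x 1 = 0" "x n = 1" "\<forall>i\<in>{1..n}. x i \<in> \<Gamma>"
    "\<forall>i\<in>{1..<n}. c i \<in> \<Gamma>" "\<forall>i\<in>{1..<n}. \<forall>t\<in>{x i<..x (Suc i)}. f t = t + c i"
    unfolding IE_carrier_def by blast
  show "piecewise f"
    unfolding piecewise_def
  proof (intro exI conjI)
    let ?T = "(\<lambda>i. (x i, x (Suc i), c i)) ` {1..<n}"
    show "finite ?T" by simp
    show "?T \<subseteq> \<Gamma> \<times> \<Gamma> \<times> \<Gamma>" using x by auto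
    show "{0<..1} \<subseteq> (\<Union>(a, b, c)\<in>?T. {a<..b})"
    proof
      fix t :: real assume "t \<in> {0<..1}"
      then obtain i where "i \<in> {1..<n}" "x i < t" "t \<le> x (Suc i)"
        using in_step[of n x t] x by auto
      then show "t \<in> (\<Union>(a, b, c)\<in>?T. {a<..b})" by auto
    qed
    show "\<forall>(a, b, c)\<in>?T. \<forall>t\<in>{a<..b} \<inter> {0<..1}. f t = t + c" using x by auto
  qed
next
  assume f: "f \<in> Bij {0..1} \<and> f 0 = 0 \<and> piecewise f"
  then obtain n :: nat and x c :: "nat \<Rightarrow> real" where "2 \<le> n" "x 1 = 0" "x n = 1"
    "\<And>i. i \<in> {1..n} \<Longrightarrow> x i \<in> \<Gamma>" "\<And>i. i \<in> {1..<n} \<Longrightarrow> x i < x (Suc i)"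
    "\<And>i. i \<in> {1..<n} \<Longrightarrow> c i \<in> \<Gamma>" "\<And>i t. i \<in> {1..<n} \<Longrightarrow> t \<in> {x i<..x (Suc i)} \<Longrightarrow> f t = t + c i"
    using steps by metis
  then show "f \<in> IE_carrier \<Gamma>"
    using f unfolding IE_carrier_def by blast
qed

lemma Bij_fix_zero:
  assumes "f \<in> Bij {0..1::real}" "f 0 = 0"
  shows "bij_betw f {0<..1} {0<..1}"
proof -
  have "bij_betw f ({0..1} - {0}) ({0..1} - {f 0})"
    using assms by (intro bij_betw_DiffI) (auto simp: Bij_def)
  moreover have "{0..1} - {0} = {0<..1::real}" by auto
  ultimately show ?thesis using assms by simp
qed

lemma subgroup_IE: "Group.subgroup (IE_carrier \<Gamma>) (BijGroup {0..1})"
proof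
  show "IE_carrier \<Gamma> \<subseteq> carrier (BijGroup {0..1})"
    by (auto simp: IE_carrier_def BijGroup_def)
next
  fix g f assume gf: "g \<in> IE_carrier \<Gamma>" "f \<in> IE_carrier \<Gamma>"
  have f: "f ` {0<..1} = {0<..1}"
    using gf Bij_fix_zero[of f] by (simp add: IE_carrier_iff bij_betw_def)
  have "piecewise (compose {0..1} g f) \<longleftrightarrow> piecewise (\<lambda>t. g (f t))"
    by (rule piecewise_cong) (simp add: compose_def)
  then have "piecewise (compose {0..1} g f)"
    using piecewise_comp[of f g] gf f by (simp add: IE_carrier_iff)
  then show "g \<otimes>\<^bsub>BijGroup {0..1}\<^esub> f \<in> IE_carrier \<Gamma>"
    using gf by (auto simp: IE_carrier_iff BijGroup_def compose_Bij) (simp add: compose_def)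
next
  have "{0<..1} \<subseteq> (\<Union>(a, b, c)\<in>{(0::real, 1::real, 0::real)}. {a<..b})" by simp
  then have "piecewise (\<lambda>x\<in>{0..1}. x)"
    unfolding piecewise_def by (intro exI[of _ "{(0, 1, 0)}"]) (auto simp: zero one)
  then show "\<one>\<^bsub>BijGroup {0..1}\<^esub> \<in> IE_carrier \<Gamma>"
    by (simp add: IE_carrier_iff BijGroup_def id_Bij)
next
  fix f assume f: "f \<in> IE_carrier \<Gamma>"
  let ?g = "inv_into {0..1} f"
  have bij: "bij_betw f {0..1} {0..1}" "bij_betw f {0<..1} {0<..1}" "f 0 = 0"
    using f Bij_fix_zero[of f] by (auto simp: IE_carrier_iff Bij_def)
  have gf: "?g (f t) = t" if "t \<in> {0..1}" for t
    using that bij by (auto simp: bij_betw_def)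
  have 0: "?g 0 = 0" using gf[of 0] bij by simp
  have fg: "?g t \<in> {0<..1} \<and> f (?g t) = t" if "t \<in> {0<..1}" for t
  proof -
    have "t \<in> f ` {0<..1}" using bij(2) that by (simp add: bij_betw_def)
    then obtain s where "t = f s" "s \<in> {0<..1}" by (rule imageE)
    then show ?thesis using gf[of s] by simp
  qed
  have "piecewise ?g"
  proof (rule piecewise_inverse[OF _ _ fg])
    show "piecewise f" using f by (simp add: IE_carrier_iff)
    show "f ` {0<..1} \<subseteq> {0<..1}" using bij(2) by (simp add: bij_betw_def)
  qed (use gf in auto)
  moreover have "piecewise (\<lambda>x\<in>{0..1}. ?g x) \<longleftrightarrow> piecewise ?g"
    by (rule piecewise_cong) simp
  ultimately have "(\<lambda>x\<in>{0..1}. ?g x) \<in> IE_carrier \<Gamma>"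
    using f 0 by (simp add: IE_carrier_iff restrict_inv_into_Bij)
  then show "inv\<^bsub>BijGroup {0..1}\<^esub> f \<in> IE_carrier \<Gamma>"
    using f by (simp add: inv_BijGroup IE_carrier_iff)
qed

sublocale G: group "IE \<Gamma>"
  using subgroup.subgroup_is_group[OF subgroup_IE group_BijGroup] by (simp add: IE_def)

lemma carrier_IE: "carrier (IE \<Gamma>) = IE_carrier \<Gamma>"
  by (simp add: IE_def)

lemma bij_IE: "f \<in> carrier (IE \<Gamma>) \<Longrightarrow> bij_betw f {0<..1} {0<..1}"
  using Bij_fix_zero by (auto simp: carrier_IE IE_carrier_iff)

lemma piecewise_IE: "f \<in> carrier (IE \<Gamma>) \<Longrightarrow> piecewise f"
  by (auto simp: carrier_IE IE_carrier_iff)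

lemma IE_in [simp]: "f \<in> carrier (IE \<Gamma>) \<Longrightarrow> x \<in> {0<..1} \<Longrightarrow> f x \<in> {0<..1}"
  by (metis bij_IE bij_betwE)

lemma IE_inj: "f \<in> carrier (IE \<Gamma>) \<Longrightarrow> x \<in> {0<..1} \<Longrightarrow> y \<in> {0<..1} \<Longrightarrow> f x = f y \<longleftrightarrow> x = y"
  by (metis bij_IE bij_betw_def inj_on_eq_iff)

lemma mult_IE [simp]:
  "f \<in> carrier (IE \<Gamma>) \<Longrightarrow> g \<in> carrier (IE \<Gamma>) \<Longrightarrow> x \<in> {0<..1} \<Longrightarrow> (g \<otimes>\<^bsub>IE \<Gamma>\<^esub> f) x = g (f x)"
  by (auto simp: IE_def BijGroup_def IE_carrier_def compose_def)

lemma one_IE [simp]: "x \<in> {0<..1} \<Longrightarrow> \<one>\<^bsub>IE \<Gamma>\<^esub> x = x"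
  by (auto simp: IE_def BijGroup_def)

lemma inv_IE [simp]:
  assumes "f \<in> carrier (IE \<Gamma>)" "x \<in> {0<..1}"
  shows "f ((inv\<^bsub>IE \<Gamma>\<^esub> f) x) = x" "(inv\<^bsub>IE \<Gamma>\<^esub> f) (f x) = x"
  using mult_IE[of f "inv\<^bsub>IE \<Gamma>\<^esub> f" x] mult_IE[of "inv\<^bsub>IE \<Gamma>\<^esub> f" f x] assms by auto

lemma IE_eqI:
  assumes "f \<in> carrier (IE \<Gamma>)" "g \<in> carrier (IE \<Gamma>)" "\<And>x. x \<in> {0<..1} \<Longrightarrow> f x = g x"
  shows "f = g"
proof (rule extensionalityI[where A = "{0..1}"])
  show "f \<in> extensional {0..1}" "g \<in> extensional {0..1}"
    using assms by (auto simp: carrier_IE IE_carrier_def Bij_def)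
  fix x :: real assume "x \<in> {0..1}"
  then show "f x = g x" using assms by (cases "x = 0") (auto simp: carrier_IE IE_carrier_def)
qed

text \<open>The source of all explicit elements: a formula on (0, 1] with an explicit inverse
  suffices, as \<open>h\<close> supplies the value 0 at 0 and \<open>undefined\<close> outside
  [0, 1]. Only \<open>f\<close> has to be checked for piecewise form.\<close>

lemma IE_exists:
  assumes "piecewise f" "\<And>x. x \<in> {0<..1} \<Longrightarrow> f x \<in> {0<..1} \<and> g x \<in> {0<..1} \<and> g (f x) = x \<and> f (g x) = x"
  obtains h where "h \<in> carrier (IE \<Gamma>)" "\<And>x. x \<in> {0<..1} \<Longrightarrow> h x = f x"
proof
  define h where "h = (\<lambda>x\<in>{0..1}. if x = 0 then 0 else f x)"
  show h: "h x = f x" if "x \<in> {0<..1}" for x using that by (simp add: h_def)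
  have "bij_betw h {0..1} {0..1}"
  proof (rule bij_betw_byWitness[where f' = "\<lambda>x. if x = 0 then 0 else g x"])
    have f: "f x \<in> {0..1}" "f x \<noteq> 0" "g (f x) = x" and g: "g x \<in> {0..1}" "g x \<noteq> 0" "f (g x) = x"
      if "x \<in> {0..1}" "x \<noteq> 0" for x
      using assms(2)[of x] that by simp_all
    show "\<forall>x\<in>{0..1}. (if h x = 0 then 0 else g (h x)) = x"
      using f by (simp add: h_def del: atLeastAtMost_iff)
    show "\<forall>x\<in>{0..1}. h (if x = 0 then 0 else g x) = x"
      using g by (simp add: h_def del: atLeastAtMost_iff)
    show "h ` {0..1} \<subseteq> {0..1}"
      using f by (simp add: h_def image_subset_iff del: atLeastAtMost_iff)
    show "(\<lambda>x. if x = 0 then 0 else g x) ` {0..1} \<subseteq> {0..1}"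
      using g by (simp add: image_subset_iff del: atLeastAtMost_iff)
  qed
  moreover have "piecewise h" using piecewise_cong[of h f] h assms(1) by simp
  ultimately show "h \<in> carrier (IE \<Gamma>)"
    by (auto simp: carrier_IE IE_carrier_iff Bij_def h_def)
qed

section \<open>Local form of elements, rotations and exchanges\<close>

lemma IE_local:
  assumes "f \<in> carrier (IE \<Gamma>)" "g \<in> carrier (IE \<Gamma>)" "x \<in> {0<..1}" "0 < \<epsilon>"
  obtains p q c d where "p \<in> \<Gamma>" "q \<in> \<Gamma>" "c \<in> \<Gamma>" "d \<in> \<Gamma>" "0 \<le> p" "q \<le> 1" "x \<in> {p<..q}" "q - p < \<epsilon>"
    "\<And>t. t \<in> {p<..q} \<Longrightarrow> f t = t + c" "\<And>t. t \<in> {p<..q} \<Longrightarrow> g t = t + d"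
proof -
  obtain a b c where 1: "a \<in> \<Gamma>" "b \<in> \<Gamma>" "c \<in> \<Gamma>" "0 \<le> a" "b \<le> 1" "x \<in> {a<..b}"
    "\<forall>t\<in>{a<..b}. f t = t + c"
    using piecewise_local[OF piecewise_IE[OF assms(1)] assms(3)] by blast
  obtain a' b' d where 2: "a' \<in> \<Gamma>" "b' \<in> \<Gamma>" "d \<in> \<Gamma>" "0 \<le> a'" "b' \<le> 1" "x \<in> {a'<..b'}"
    "\<forall>t\<in>{a'<..b'}. g t = t + d"
    using piecewise_local[OF piecewise_IE[OF assms(2)] assms(3)] by blast
  have "max a a' \<in> \<Gamma>" "min b b' \<in> \<Gamma>" "x \<in> {max a a'<..min b b'}"
    using 1(1,2,6) 2(1,2,6) by (auto simp: min_max)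
  then obtain p q where "p \<in> \<Gamma>" "q \<in> \<Gamma>" "max a a' \<le> p" "p < x" "x \<le> q" "q \<le> min b b'" "q - p < \<epsilon>"
    using shrink[of "max a a'" "min b b'" x \<epsilon>] assms by metis
  then show ?thesis using 1 2 by (intro that[of p q c d]) auto
qed

text \<open>The formula is the rotation by \<open>e\<close> of (p, q] seen as a circle of length
  \<open>q - p\<close>; its inverse is the rotation by \<open>-e\<close>.\<close>

lemma rotation:
  assumes "p \<in> \<Gamma>" "q \<in> \<Gamma>" "e \<in> \<Gamma>" "0 \<le> p" "q \<le> 1" "0 < e" "e < q - p"
  obtains r where "r \<in> carrier (IE \<Gamma>)" "\<And>x. x \<in> {0<..1} \<Longrightarrow> x \<notin> {p<..q} \<Longrightarrow> r x = x"
    "\<And>x. x \<in> {p<..q - e} \<Longrightarrow> r x = x + e" "\<And>x. x \<in> {q - e<..q} \<Longrightarrow> r x = x + e - (q - p)"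
proof -
  define f where "f x = (if x \<in> {p<..q - e} then x + e else if x \<in> {q - e<..q} then x + e - (q - p) else x)" for x
  define g where "g x = (if x \<in> {p<..p + e} then x - e + (q - p) else if x \<in> {p + e<..q} then x - e else x)" for x
  let ?T = "{(0, p, 0), (p, q - e, e), (q - e, q, e - (q - p)), (q, 1, 0)}"
  have "?T \<subseteq> \<Gamma> \<times> \<Gamma> \<times> \<Gamma>" using assms by (auto simp: zero one diff)
  moreover have "{0<..1} \<subseteq> (\<Union>(a, b, c)\<in>?T. {a<..b})" by auto
  moreover have "\<forall>(a, b, c)\<in>?T. \<forall>t\<in>{a<..b} \<inter> {0<..1}. f t = t + c"
    using assms by (auto simp: f_def)
  ultimately have "piecewise f" unfolding piecewise_def by (intro exI[of _ ?T]) blast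
  moreover have "f x \<in> {0<..1} \<and> g x \<in> {0<..1} \<and> g (f x) = x \<and> f (g x) = x" if "x \<in> {0<..1}" for x
    using that assms by (auto simp: f_def g_def)
  ultimately obtain r where "r \<in> carrier (IE \<Gamma>)" "\<And>x. x \<in> {0<..1} \<Longrightarrow> r x = f x"
    using IE_exists by blast
  then show ?thesis
    using assms by (intro that[of r]) (auto simp: f_def)
qed

lemma exchange:
  assumes "p \<in> \<Gamma>" "q \<in> \<Gamma>" "l \<in> \<Gamma>" "0 \<le> p" "p + l \<le> q" "q + l \<le> 1" "0 < l"
  obtains r where "r \<in> carrier (IE \<Gamma>)" "\<And>x. x \<in> {p<..p + l} \<Longrightarrow> r x = x + (q - p)"
    "\<And>x. x \<in> {q<..q + l} \<Longrightarrow> r x = x - (q - p)"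
    "\<And>x. x \<in> {0<..1} \<Longrightarrow> x \<notin> {p<..p + l} \<Longrightarrow> x \<notin> {q<..q + l} \<Longrightarrow> r x = x"
proof -
  define f where "f x = (if x \<in> {p<..p + l} then x + (q - p) else if x \<in> {q<..q + l} then x - (q - p) else x)" for x
  let ?T = "{(0, p, 0), (p, p + l, q - p), (p + l, q, 0), (q, q + l, p - q), (q + l, 1, 0)}"
  have "?T \<subseteq> \<Gamma> \<times> \<Gamma> \<times> \<Gamma>" using assms by (auto simp: zero one diff add)
  moreover have "{0<..1} \<subseteq> (\<Union>(a, b, c)\<in>?T. {a<..b})" by auto
  moreover have "\<forall>(a, b, c)\<in>?T. \<forall>t\<in>{a<..b} \<inter> {0<..1}. f t = t + c"
    using assms by (auto simp: f_def)
  ultimately have "piecewise f" unfolding piecewise_def by (intro exI[of _ ?T]) blast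
  \<comment> \<open>Swapping two disjoint intervals is its own inverse, so \<open>f\<close> plays
    both roles in \<open>IE_exists\<close>.\<close>
  moreover have "f x \<in> {0<..1} \<and> f x \<in> {0<..1} \<and> f (f x) = x \<and> f (f x) = x" if "x \<in> {0<..1}" for x
    using that assms by (auto simp: f_def)
  ultimately obtain r where "r \<in> carrier (IE \<Gamma>)" "\<And>x. x \<in> {0<..1} \<Longrightarrow> r x = f x"
    using IE_exists by blast
  then show ?thesis
    using assms by (intro that[of r]) (auto simp: f_def)
qed

section \<open>Inclusion of supports in terms of the group structure\<close>

lemma commute_iff:
  assumes "f \<in> carrier (IE \<Gamma>)" "g \<in> carrier (IE \<Gamma>)"
  shows "f \<otimes>\<^bsub>IE \<Gamma>\<^esub> g = g \<otimes>\<^bsub>IE \<Gamma>\<^esub> f \<longleftrightarrow> (\<forall>x\<in>{0<..1}. f (g x) = g (f x))"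
proof
  assume eq: "f \<otimes>\<^bsub>IE \<Gamma>\<^esub> g = g \<otimes>\<^bsub>IE \<Gamma>\<^esub> f"
  show "\<forall>x\<in>{0<..1}. f (g x) = g (f x)"
  proof
    fix x :: real assume x: "x \<in> {0<..1}"
    have "(f \<otimes>\<^bsub>IE \<Gamma>\<^esub> g) x = (g \<otimes>\<^bsub>IE \<Gamma>\<^esub> f) x" using eq by simp
    then show "f (g x) = g (f x)" by (simp only: mult_IE assms x)
  qed
next
  assume "\<forall>x\<in>{0<..1}. f (g x) = g (f x)"
  then show "f \<otimes>\<^bsub>IE \<Gamma>\<^esub> g = g \<otimes>\<^bsub>IE \<Gamma>\<^esub> f"
    by (intro IE_eqI) (simp_all add: assms)
qed

lemma commuteD:
  assumes "f \<in> centraliser (IE \<Gamma>) S" "g \<in> S" "g \<in> carrier (IE \<Gamma>)" "x \<in> {0<..1}"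
  shows "f (g x) = g (f x)"
  using assms commute_iff[of f g] unfolding centraliser_def by blast

lemma not_supp: "x \<in> {0<..1} \<Longrightarrow> x \<notin> supp f \<Longrightarrow> f x = x"
  by (auto simp: supp_def)

lemma supp_invariant:
  assumes "f \<in> carrier (IE \<Gamma>)" "x \<in> {0<..1}"
  shows "f x \<in> supp f \<longleftrightarrow> x \<in> supp f"
  using IE_in[OF assms] assms IE_inj[OF assms(1) _ assms(2), of "f x"] by (simp add: supp_def)

text \<open>Each map preserves its own support, so at a point of one support the other map fixes
  both the point and its image.\<close>

lemma commute_disjoint:
  assumes "f \<in> carrier (IE \<Gamma>)" "g \<in> carrier (IE \<Gamma>)" "supp f \<inter> supp g = {}"
  shows "f \<otimes>\<^bsub>IE \<Gamma>\<^esub> g = g \<otimes>\<^bsub>IE \<Gamma>\<^esub> f"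
  unfolding commute_iff[OF assms(1,2)]
proof
  fix x :: real assume x: "x \<in> {0<..1}"
  show "f (g x) = g (f x)"
  proof (cases "x \<in> supp f")
    case True
    then have "f x \<in> supp f" using supp_invariant assms x by blast
    then have "g x = x" "g (f x) = f x"
      using True assms x by (auto intro!: not_supp simp del: greaterThanAtMost_iff)
    then show ?thesis by simp
  next
    case False
    then have fx: "f x = x" by (rule not_supp[OF x])
    show ?thesis
    proof (cases "x \<in> supp g")
      case True
      then have "g x \<in> supp g" using supp_invariant assms x by blast
      then have "f (g x) = g x"
        using True assms x by (auto intro!: not_supp simp del: greaterThanAtMost_iff)
      then show ?thesis using fx by simp
    next
      case False
      then show ?thesis using fx not_supp[OF x False] by simp
    qed
  qed
qed

lemma supp_empty:
  assumes "f \<in> carrier (IE \<Gamma>)" "supp f = {}"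
  shows "f = \<one>\<^bsub>IE \<Gamma>\<^esub>"
  using assms by (intro IE_eqI) (auto simp: supp_def)

section \<open>Displaced intervals and test elements living on them\<close>

text \<open>Near \<open>x\<close> the map \<open>f\<close> is a translation by
  \<open>f x - x\<close>, which carries any interval shorter than that distance off itself. The
  second element \<open>g\<close> comes along so that its action on the same interval is also under
  control.\<close>

lemma moved_off:
  assumes "f \<in> carrier (IE \<Gamma>)" "g \<in> carrier (IE \<Gamma>)" "x \<in> supp f"
  obtains p q d where "p \<in> \<Gamma>" "q \<in> \<Gamma>" "0 \<le> p" "q \<le> 1" "x \<in> {p<..q}" "{p<..q} \<subseteq> {0<..1}"
    "\<And>t. t \<in> {p<..q} \<Longrightarrow> f t \<notin> {p<..q}" "\<And>t. t \<in> {p<..q} \<Longrightarrow> g t = t + d"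
proof -
  have x: "x \<in> {0<..1}" "0 < \<bar>f x - x\<bar>" using assms(3) by (auto simp: supp_def)
  obtain p q c d where *: "p \<in> \<Gamma>" "q \<in> \<Gamma>" "c \<in> \<Gamma>" "d \<in> \<Gamma>" "0 \<le> p" "q \<le> 1" "x \<in> {p<..q}"
    "q - p < \<bar>f x - x\<bar>" and f: "\<And>t. t \<in> {p<..q} \<Longrightarrow> f t = t + c"
    and g: "\<And>t. t \<in> {p<..q} \<Longrightarrow> g t = t + d"
    using IE_local[OF assms(1,2) x] by metis
  have "q - p < \<bar>c\<bar>" using f[OF *(7)] *(8) by simp
  then have "f t \<notin> {p<..q}" if "t \<in> {p<..q}" for t
    using f[OF that] that by auto
  then show ?thesis using * g by (intro that[of p q d]) auto
qed

text \<open>A test element with support a prescribed interval, whose square has no fixed point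
  there: a rotation by less than half the length.\<close>

lemma spin:
  assumes "p \<in> \<Gamma>" "q \<in> \<Gamma>" "0 \<le> p" "p < q" "q \<le> 1"
  obtains r where "r \<in> carrier (IE \<Gamma>)" "supp r = {p<..q}"
    "\<And>t. t \<in> {p<..q} \<Longrightarrow> r t \<in> {p<..q}" "\<And>t. t \<in> {p<..q} \<Longrightarrow> r (r t) \<noteq> t"
proof -
  \<comment> \<open>The square rotates by \<open>2 * e\<close>, which must be less than the full
    length \<open>q - p\<close> to move every point.\<close>
  obtain e where e: "e \<in> \<Gamma>" "0 < e" "e < (q - p) / 2"
    using between[of 0 "(q - p) / 2"] assms by auto
  then have "e < q - p" by (simp add: field_simps)
  then obtain r where r: "r \<in> carrier (IE \<Gamma>)" "\<And>x. x \<in> {0<..1} \<Longrightarrow> x \<notin> {p<..q} \<Longrightarrow> r x = x"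
    "\<And>x. x \<in> {p<..q - e} \<Longrightarrow> r x = x + e" "\<And>x. x \<in> {q - e<..q} \<Longrightarrow> r x = x + e - (q - p)"
    using rotation[of p q e] assms e by metis
  have *: "r t \<in> {p<..q} \<and> r t \<noteq> t \<and> r (r t) \<noteq> t" if "t \<in> {p<..q}" for t
  proof (cases "t \<in> {p<..q - e}")
    case True
    then have "r t = t + e" by (rule r(3))
    then show ?thesis
      using r(3)[of "t + e"] r(4)[of "t + e"] True e by (cases "t + e \<in> {p<..q - e}") auto
  next
    case False
    then have t: "t \<in> {q - e<..q}" using that by auto
    then have "r t = t + e - (q - p)" by (rule r(4))
    then show ?thesis
      using r(3)[of "t + e - (q - p)"] t e by auto
  qed
  have "supp r = {p<..q}"
  proof (intro equalityI subsetI)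
    show "x \<in> {p<..q}" if "x \<in> supp r" for x
      using that r(2)[of x] by (cases "x \<in> {p<..q}") (simp_all add: supp_def)
    show "x \<in> supp r" if "x \<in> {p<..q}" for x
      using that *[OF that] assms by (simp add: supp_def)
  qed
  then show ?thesis using * r(1) by (intro that[of r]) blast+
qed

lemma involution_exists:
  assumes "p \<in> \<Gamma>" "q \<in> \<Gamma>" "0 \<le> p" "p < q" "q \<le> 1"
  obtains r where "r \<in> carrier (IE \<Gamma>)" "supp r \<noteq> {}" "supp r \<subseteq> {p<..q}" "r \<otimes>\<^bsub>IE \<Gamma>\<^esub> r = \<one>\<^bsub>IE \<Gamma>\<^esub>"
proof -
  \<comment> \<open>Below half the length, two adjacent intervals of length \<open>e\<close> fit
    into (p, q]; they are swapped.\<close>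
  obtain e where e: "e \<in> \<Gamma>" "0 < e" "e < (q - p) / 2"
    using between[of 0 "(q - p) / 2"] assms by auto
  have "p + e \<in> \<Gamma>" "p + e + e \<le> 1" using e assms by (auto intro: add simp: field_simps)
  then obtain r where r: "r \<in> carrier (IE \<Gamma>)" "\<And>x. x \<in> {p<..p + e} \<Longrightarrow> r x = x + (p + e - p)"
    "\<And>x. x \<in> {p + e<..p + e + e} \<Longrightarrow> r x = x - (p + e - p)"
    "\<And>x. x \<in> {0<..1} \<Longrightarrow> x \<notin> {p<..p + e} \<Longrightarrow> x \<notin> {p + e<..p + e + e} \<Longrightarrow> r x = x"
    using exchange[of p "p + e" e] assms e by auto
  have "r (r x) = x" if "x \<in> {0<..1}" for x
    using r(2,3)[of x] r(4)[OF that] r(2)[of "x - e"] r(3)[of "x + e"] e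
    by (cases "x \<in> {p<..p + e}"; cases "x \<in> {p + e<..p + e + e}") auto
  then have "r \<otimes>\<^bsub>IE \<Gamma>\<^esub> r = \<one>\<^bsub>IE \<Gamma>\<^esub>"
    using r(1) by (intro IE_eqI) simp_all
  moreover have "p + e \<in> supp r" using r(2)[of "p + e"] e assms by (auto simp: supp_def field_simps)
  moreover have "supp r \<subseteq> {p<..q}" using r(4) e assms by (fastforce simp: supp_def field_simps)
  ultimately show ?thesis using r(1) by (intro that[of r]) auto
qed

section \<open>Twists of an involution\<close>

lemma twistsD:
  assumes "u \<in> twists (IE \<Gamma>) p" "p \<in> carrier (IE \<Gamma>)"
  shows "u \<in> carrier (IE \<Gamma>)" "\<And>x. x \<in> {0<..1} \<Longrightarrow> u (u x) = x"
    "\<And>v x. v \<in> carrier (IE \<Gamma>) \<Longrightarrow> v \<otimes>\<^bsub>IE \<Gamma>\<^esub> p = p \<otimes>\<^bsub>IE \<Gamma>\<^esub> v \<Longrightarrow> x \<in> {0<..1} \<Longrightarrow>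
      u (v (u ((inv\<^bsub>IE \<Gamma>\<^esub> v) x))) = v (u ((inv\<^bsub>IE \<Gamma>\<^esub> v) (u x)))"
proof -
  show u: "u \<in> carrier (IE \<Gamma>)"
    using assms by (simp add: twists_def centraliser_def)
  have uu: "u \<otimes>\<^bsub>IE \<Gamma>\<^esub> u = \<one>\<^bsub>IE \<Gamma>\<^esub>" using assms by (simp add: twists_def)
  show "u (u x) = x" if "x \<in> {0<..1}" for x
    using mult_IE[OF u u that] uu one_IE[OF that] by simp
  fix v and x :: real
  assume v: "v \<in> carrier (IE \<Gamma>)" "v \<otimes>\<^bsub>IE \<Gamma>\<^esub> p = p \<otimes>\<^bsub>IE \<Gamma>\<^esub> v" and x: "x \<in> {0<..1}"
  let ?w = "v \<otimes>\<^bsub>IE \<Gamma>\<^esub> u \<otimes>\<^bsub>IE \<Gamma>\<^esub> inv\<^bsub>IE \<Gamma>\<^esub> v"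
  have "v \<in> centraliser (IE \<Gamma>) {p}" using v by (simp add: centraliser_def)
  then have "u \<in> centraliser (IE \<Gamma>) {?w}"
    using assms(1) unfolding twists_def by blast
  then have "u (?w x) = ?w (u x)" by (rule commuteD) (use x u v in auto)
  then show "u (v (u ((inv\<^bsub>IE \<Gamma>\<^esub> v) x))) = v (u ((inv\<^bsub>IE \<Gamma>\<^esub> v) (u x)))"
    using IE_in[OF u x] IE_in[of "inv\<^bsub>IE \<Gamma>\<^esub> v" x] u v x by (simp del: greaterThanAtMost_iff)
qed

text \<open>Suppose \<open>u\<close> moves a point \<open>x\<close> fixed by \<open>p\<close>. A
  spin \<open>r\<close> on a small interval around \<open>x\<close>, fixed by \<open>p\<close> and
  displaced by \<open>u\<close>, commutes with \<open>p\<close>, so \<open>u\<close> commutes with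
  \<open>r u r^-1\<close>. Evaluated at \<open>r x\<close>, one order of composition gives
  \<open>x\<close> and the other \<open>r (r (r x))\<close> without one factor, that is
  \<open>r (r x)\<close>; a spin never has \<open>r (r x) = x\<close>.\<close>

lemma supp_twist:
  assumes "u \<in> twists (IE \<Gamma>) p" "p \<in> carrier (IE \<Gamma>)"
  shows "supp u \<subseteq> supp p"
proof
  fix x assume x: "x \<in> supp u"
  note u = twistsD[OF assms]
  show "x \<in> supp p"
  proof (rule ccontr)
    assume "x \<notin> supp p"
    then have px: "p x = x" using x by (auto simp: supp_def)
    obtain a b d where I: "a \<in> \<Gamma>" "b \<in> \<Gamma>" "0 \<le> a" "b \<le> 1" "x \<in> {a<..b}" "{a<..b} \<subseteq> {0<..1}"
      and off: "\<And>t. t \<in> {a<..b} \<Longrightarrow> u t \<notin> {a<..b}" and p: "\<And>t. t \<in> {a<..b} \<Longrightarrow> p t = t + d"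
      using moved_off[OF u(1) assms(2) x] by metis
    have "d = 0" using p[OF I(5)] px by simp
    then have p: "p t = t" if "t \<in> {a<..b}" for t using p[OF that] by simp
    have "a < b" using I(5) by simp
    then obtain r where r: "r \<in> carrier (IE \<Gamma>)" "supp r = {a<..b}"
      "\<And>t. t \<in> {a<..b} \<Longrightarrow> r t \<in> {a<..b}" "\<And>t. t \<in> {a<..b} \<Longrightarrow> r (r t) \<noteq> t"
      using spin[of a b] I by metis
    have fix_r: "r t = t" "(inv\<^bsub>IE \<Gamma>\<^esub> r) t = t" if "t \<in> {0<..1}" "t \<notin> {a<..b}" for t
    proof -
      show "r t = t" using not_supp[of t r] that r(2) by blast
      then show "(inv\<^bsub>IE \<Gamma>\<^esub> r) t = t" using inv_IE(2)[OF r(1) that(1)] by simp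
    qed
    have "supp r \<inter> supp p = {}" using r(2) p by (auto simp: supp_def)
    then have comm: "r \<otimes>\<^bsub>IE \<Gamma>\<^esub> p = p \<otimes>\<^bsub>IE \<Gamma>\<^esub> r" by (rule commute_disjoint[OF r(1) assms(2)])
    define z where "z = r x"
    have z: "z \<in> {a<..b}" "z \<in> {0<..1}" and x01: "x \<in> {0<..1}"
      using r(3)[OF I(5)] I(5,6) unfolding z_def by blast+
    have ux: "u x \<in> {0<..1}" "u x \<notin> {a<..b}" "u z \<in> {0<..1}" "u z \<notin> {a<..b}"
      using IE_in[OF u(1)] x01 z off I(5) by blast+
    have "(inv\<^bsub>IE \<Gamma>\<^esub> r) z = x" unfolding z_def by (rule inv_IE(2)[OF r(1) x01])
    then have "u (r (u x)) = r (u ((inv\<^bsub>IE \<Gamma>\<^esub> r) (u z)))"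
      using u(3)[OF r(1) comm z(2)] by simp
    then have "x = r z" using fix_r ux u(2)[OF x01] u(2)[OF z(2)] by simp
    then show False using r(4)[OF I(5)] by (simp add: z_def)
  qed
qed

text \<open>If \<open>v\<close> commutes with \<open>p\<close>, conjugating \<open>s\<close> by
  \<open>v\<close> yields the map that is \<open>p\<close> on the image of \<open>J\<close> under
  \<open>v\<close> and the identity elsewhere. Both maps act at each point as \<open>p\<close> or as
  the identity, and both commute with \<open>p\<close>, so they commute with each other.\<close>

lemma exchange_twist:
  assumes p: "p \<in> carrier (IE \<Gamma>)" "p \<otimes>\<^bsub>IE \<Gamma>\<^esub> p = \<one>\<^bsub>IE \<Gamma>\<^esub>"
    and s: "s \<in> carrier (IE \<Gamma>)" and J: "\<And>x. x \<in> {0<..1} \<Longrightarrow> s x = (if x \<in> J then p x else x)"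
    and inv: "\<And>x. x \<in> {0<..1} \<Longrightarrow> p x \<in> J \<longleftrightarrow> x \<in> J"
  shows "s \<in> twists (IE \<Gamma>) p"
proof -
  have pp: "p (p x) = x" if "x \<in> {0<..1}" for x
    using mult_IE[OF p(1) p(1) that] p(2) one_IE[OF that] by simp
  have sp: "s (p x) = p (s x)" if "x \<in> {0<..1}" for x
    using J[OF that] J[OF IE_in[OF p(1) that]] inv[OF that] by simp
  then have "s \<in> centraliser (IE \<Gamma>) {p}"
    using p s by (simp add: centraliser_def commute_iff)
  moreover have "s \<otimes>\<^bsub>IE \<Gamma>\<^esub> s = \<one>\<^bsub>IE \<Gamma>\<^esub>"
  proof (rule IE_eqI)
    fix x :: real assume x: "x \<in> {0<..1}"
    have "s (s x) = x"
      using J[OF x] J[OF IE_in[OF p(1) x]] inv[OF x] pp[OF x] by simp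
    then show "(s \<otimes>\<^bsub>IE \<Gamma>\<^esub> s) x = \<one>\<^bsub>IE \<Gamma>\<^esub> x" by (simp only: mult_IE[OF s s x] one_IE[OF x])
  qed (use s in auto)
  moreover have "s \<in> centraliser (IE \<Gamma>) {v \<otimes>\<^bsub>IE \<Gamma>\<^esub> s \<otimes>\<^bsub>IE \<Gamma>\<^esub> inv\<^bsub>IE \<Gamma>\<^esub> v}"
    if "v \<in> centraliser (IE \<Gamma>) {p}" for v
  proof -
    have v: "v \<in> carrier (IE \<Gamma>)" and vp: "\<And>x. x \<in> {0<..1} \<Longrightarrow> v (p x) = p (v x)"
      using that commuteD[OF that _ p(1)] by (auto simp: centraliser_def)
    let ?w = "v \<otimes>\<^bsub>IE \<Gamma>\<^esub> s \<otimes>\<^bsub>IE \<Gamma>\<^esub> inv\<^bsub>IE \<Gamma>\<^esub> v"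
    have w: "?w x = (if (inv\<^bsub>IE \<Gamma>\<^esub> v) x \<in> J then p x else x)" if x: "x \<in> {0<..1}" for x
    proof -
      let ?y = "(inv\<^bsub>IE \<Gamma>\<^esub> v) x"
      have y: "?y \<in> {0<..1}" by (rule IE_in[OF G.inv_closed[OF v] x])
      have "?w x = v (s ?y)" using v s x y by (simp del: greaterThanAtMost_iff)
      then show ?thesis using J[OF y] vp[OF y] inv_IE(1)[OF v x] by simp
    qed
    have wp: "?w (p x) = p (?w x)" if x: "x \<in> {0<..1}" for x
    proof -
      let ?y = "(inv\<^bsub>IE \<Gamma>\<^esub> v) x"
      have y: "?y \<in> {0<..1}" by (rule IE_in[OF G.inv_closed[OF v] x])
      have "p x = v (p ?y)" using vp[OF y] inv_IE(1)[OF v x] by simp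
      then have "(inv\<^bsub>IE \<Gamma>\<^esub> v) (p x) = p ?y" using inv_IE(2)[OF v IE_in[OF p(1) y]] by simp
      then show ?thesis using w[OF x] w[OF IE_in[OF p(1) x]] inv[OF y] by simp
    qed
    have "s (?w x) = ?w (s x)" if x: "x \<in> {0<..1}" for x
      using sp[OF x] wp[OF x] J[OF x] w[OF x] by (auto split: if_splits)
    then show ?thesis using v s by (simp add: centraliser_def commute_iff)
  qed
  ultimately show ?thesis by (simp add: twists_def)
qed

text \<open>Commuting with the twists forces \<open>v x\<close> to be \<open>x\<close> or
  \<open>p x\<close>. As \<open>v\<close> also commutes with \<open>p\<close>, the second case gives
  \<open>v (v x) = p (p x) = x\<close>.\<close>

lemma square_fixes_supp:
  assumes p: "p \<in> carrier (IE \<Gamma>)" "p \<otimes>\<^bsub>IE \<Gamma>\<^esub> p = \<one>\<^bsub>IE \<Gamma>\<^esub>"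
    and v: "v \<in> centraliser (IE \<Gamma>) (twists (IE \<Gamma>) p)" and x: "x \<in> supp p"
  shows "v (v x) = x"
proof -
  have vc: "v \<in> carrier (IE \<Gamma>)" using v by (simp add: centraliser_def)
  have x01: "x \<in> {0<..1}" using x by (auto simp: supp_def)
  have pp: "p (p x) = x" if "x \<in> {0<..1}" for x
    using mult_IE[OF p(1) p(1) that] p(2) one_IE[OF that] by simp
  \<comment> \<open>With \<open>J = UNIV\<close> the map of \<open>exchange_twist\<close> is
    \<open>p\<close> itself.\<close>
  have "p \<in> twists (IE \<Gamma>) p"
    by (rule exchange_twist[OF p p(1), of UNIV]) auto
  then have vp: "v (p x) = p (v x)" using commuteD[OF v _ p(1) x01] by simp
  txt \<open>
    Otherwise \<open>v x\<close> avoids \<open>I \<union> p I\<close> for some small interval \<open>I\<close> around \<open>x\<close>, and \<open>v\<close> cannot commute with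
    the twist that agrees with \<open>p\<close> on \<open>I \<union> p I\<close> and is trivial elsewhere.
  \<close>
  have "v x = x \<or> v x = p x"
  proof (rule ccontr)
    assume vx: "\<not> (v x = x \<or> v x = p x)"
    \<comment> \<open>The three distances keep \<open>v x\<close> out of I, keep \<open>v x\<close>
      out of p I, and make I and p I disjoint.\<close>
    define \<epsilon> where "\<epsilon> = min (min \<bar>v x - x\<bar> \<bar>v x - p x\<bar>) \<bar>p x - x\<bar>"
    have "0 < \<epsilon>" using vx x by (auto simp: \<epsilon>_def supp_def)
    then obtain a b c where I: "a \<in> \<Gamma>" "b \<in> \<Gamma>" "c \<in> \<Gamma>" "0 \<le> a" "b \<le> 1" "x \<in> {a<..b}" "b - a < \<epsilon>"
      and c: "\<And>t. t \<in> {a<..b} \<Longrightarrow> p t = t + c"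
      using IE_local[OF p(1) p(1) x01] by metis
    have px: "p x = x + c" using c I by simp
    have "b - a < \<bar>c\<bar>" using I(7) px by (simp add: \<epsilon>_def)
    have c': "p t = t - c" if "t \<in> {a + c<..b + c}" for t
      using pp[of "t - c"] c[of "t - c"] that I by simp
    have range: "0 \<le> a + c" "b + c \<le> 1"
    proof -
      have pos: "0 < t + c" if t: "t \<in> {a<..b}" for t
      proof -
        have "t \<in> {0<..1}" using t I by auto
        then show ?thesis using IE_in[OF p(1), of t] c[OF t] by simp
      qed
      \<comment> \<open>If \<open>a + c\<close> were negative, the point \<open>min b (- c)\<close>
        of (a, b] would be sent to a value that is not positive.\<close>
      show "0 \<le> a + c" using pos[of "min b (- c)"] I by (cases "a + c < 0") auto
      show "b + c \<le> 1" using c[of b] IE_in[OF p(1), of b] I by auto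
    qed
    let ?J = "{a<..b} \<union> {a + c<..b + c}"
    have e: "a + (b - a) = b" "a + c + (b - a) = b + c" "a + c - a = c" "a - (a + c) = - c" by simp_all
    obtain s where s: "s \<in> carrier (IE \<Gamma>)" "\<And>x. x \<in> {0<..1} \<Longrightarrow> s x = (if x \<in> ?J then p x else x)"
    \<comment> \<open>The lemma \<open>exchange\<close> expects the left interval first; the sign of
      \<open>c\<close> tells which of I and p I that is.\<close>
    proof (cases "c > 0")
      case True
      obtain s where s: "s \<in> carrier (IE \<Gamma>)" "\<And>x. x \<in> {a<..a + (b - a)} \<Longrightarrow> s x = x + (a + c - a)"
        "\<And>x. x \<in> {a + c<..a + c + (b - a)} \<Longrightarrow> s x = x - (a + c - a)"
        "\<And>x. x \<in> {0<..1} \<Longrightarrow> x \<notin> {a<..a + (b - a)} \<Longrightarrow> x \<notin> {a + c<..a + c + (b - a)} \<Longrightarrow> s x = x"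
        by (rule exchange[of a "a + c" "b - a"])
          (use True \<open>b - a < \<bar>c\<bar>\<close> range I in \<open>auto simp: diff add\<close>)
      show ?thesis
        by (rule that[OF s(1)]) (use s(2-4)[unfolded e] c c' in auto)
    next
      case False
      obtain s where s: "s \<in> carrier (IE \<Gamma>)" "\<And>x. x \<in> {a + c<..a + c + (b - a)} \<Longrightarrow> s x = x + (a - (a + c))"
        "\<And>x. x \<in> {a<..a + (b - a)} \<Longrightarrow> s x = x - (a - (a + c))"
        "\<And>x. x \<in> {0<..1} \<Longrightarrow> x \<notin> {a + c<..a + c + (b - a)} \<Longrightarrow> x \<notin> {a<..a + (b - a)} \<Longrightarrow> s x = x"
        by (rule exchange[of "a + c" a "b - a"])
          (use False \<open>b - a < \<bar>c\<bar>\<close> range I in \<open>auto simp: diff add\<close>)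
      show ?thesis
        by (rule that[OF s(1)]) (use s(2-4)[unfolded e] c c' in auto)
    qed
    have J1: "p t \<in> ?J" if "t \<in> ?J" for t
      using that c[of t] c'[of t] by auto
    have "p t \<in> ?J \<longleftrightarrow> t \<in> ?J" if "t \<in> {0<..1}" for t
      using J1[of t] J1[of "p t"] pp[OF that] by metis
    from exchange_twist[OF p s this] have "s \<in> twists (IE \<Gamma>) p" .
    then have "v (s x) = s (v x)" using commuteD[OF v _ s(1) x01] by simp
    moreover have "s x = p x" using s(2)[OF x01] I by simp
    moreover have "v x \<notin> ?J" using I(6,7) px by (auto simp: \<epsilon>_def)
    then have "s (v x) = v x" using s(2)[OF IE_in[OF vc x01]] by (simp only: if_False)
    ultimately have "v (p x) = v x" by simp
    then show False using IE_inj[OF vc IE_in[OF p(1) x01] x01] x by (simp add: supp_def)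
  qed
  then show ?thesis using vp pp[OF x01] by auto
qed

section \<open>Supports read off from centralisers\<close>

text \<open>If \<open>w\<close> moves a point \<open>x\<close> fixed by \<open>p\<close>, a spin
  \<open>r\<close> on a small interval around \<open>x\<close> is disjoint from all twists, so
  \<open>w\<close> commutes with the square of \<open>r\<close>. But \<open>w x\<close> lies off the
  interval, which gives \<open>w (r (r x)) = w x\<close>, contradicting injectivity. Conversely the
  squares are trivial on \<open>supp p\<close>, hence disjoint from everything supported
  there.\<close>

lemma rigid_eq:
  assumes p: "p \<in> carrier (IE \<Gamma>)" "p \<otimes>\<^bsub>IE \<Gamma>\<^esub> p = \<one>\<^bsub>IE \<Gamma>\<^esub>"
  shows "rigid (IE \<Gamma>) p = {w \<in> carrier (IE \<Gamma>). supp w \<subseteq> supp p}"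
proof (intro equalityI subsetI CollectI conjI)
  fix w assume w: "w \<in> rigid (IE \<Gamma>) p"
  then show wc: "w \<in> carrier (IE \<Gamma>)" by (simp add: rigid_def centraliser_def)
  show "x \<in> supp p" if x: "x \<in> supp w" for x
  proof (rule ccontr)
    assume "x \<notin> supp p"
    then have px: "p x = x" using x by (auto simp: supp_def)
    obtain a b d where I: "a \<in> \<Gamma>" "b \<in> \<Gamma>" "0 \<le> a" "b \<le> 1" "x \<in> {a<..b}" "{a<..b} \<subseteq> {0<..1}"
      and off: "\<And>t. t \<in> {a<..b} \<Longrightarrow> w t \<notin> {a<..b}" and p': "\<And>t. t \<in> {a<..b} \<Longrightarrow> p t = t + d"
      using moved_off[OF wc p(1) x] by metis
    have "d = 0" using p'[OF I(5)] px by simp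
    then have pI: "p t = t" if "t \<in> {a<..b}" for t using p'[OF that] by simp
    have "a < b" using I(5) by simp
    then obtain r where r: "r \<in> carrier (IE \<Gamma>)" "supp r = {a<..b}"
      "\<And>t. t \<in> {a<..b} \<Longrightarrow> r t \<in> {a<..b}" "\<And>t. t \<in> {a<..b} \<Longrightarrow> r (r t) \<noteq> t"
      using spin[of a b] I by metis
    have "r \<otimes>\<^bsub>IE \<Gamma>\<^esub> u = u \<otimes>\<^bsub>IE \<Gamma>\<^esub> r" if "u \<in> twists (IE \<Gamma>) p" for u
    proof (rule commute_disjoint[OF r(1) twistsD(1)[OF that p(1)]])
      have "supp r \<inter> supp p = {}" using r(2) pI by (auto simp: supp_def)
      then show "supp r \<inter> supp u = {}" using supp_twist[OF that p(1)] by blast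
    qed
    then have "r \<in> centraliser (IE \<Gamma>) (twists (IE \<Gamma>) p)" using r(1) by (simp add: centraliser_def)
    then have "w ((r \<otimes>\<^bsub>IE \<Gamma>\<^esub> r) x) = (r \<otimes>\<^bsub>IE \<Gamma>\<^esub> r) (w x)"
      using w I r(1) unfolding rigid_def by (intro commuteD) auto
    moreover have x01: "x \<in> {0<..1}" "w x \<in> {0<..1}" using I IE_in[OF wc] by blast+
    moreover have "r (w x) = w x" using not_supp[OF x01(2)] off[OF I(5)] r(2) by blast
    ultimately have "w (r (r x)) = w x" using r(1) by (simp del: greaterThanAtMost_iff)
    then have "r (r x) = x" using IE_inj[OF wc _ x01(1)] IE_in[OF r(1)] x01(1) by blast
    then show False using r(4)[OF I(5)] by simp
  qed
next
  fix w assume "w \<in> {w \<in> carrier (IE \<Gamma>). supp w \<subseteq> supp p}"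
  then have w: "w \<in> carrier (IE \<Gamma>)" "supp w \<subseteq> supp p" by auto
  have "w \<otimes>\<^bsub>IE \<Gamma>\<^esub> (v \<otimes>\<^bsub>IE \<Gamma>\<^esub> v) = (v \<otimes>\<^bsub>IE \<Gamma>\<^esub> v) \<otimes>\<^bsub>IE \<Gamma>\<^esub> w"
    if "v \<in> centraliser (IE \<Gamma>) (twists (IE \<Gamma>) p)" for v
  proof (rule commute_disjoint)
    show v: "v \<otimes>\<^bsub>IE \<Gamma>\<^esub> v \<in> carrier (IE \<Gamma>)" using that by (simp add: centraliser_def)
    have "(v \<otimes>\<^bsub>IE \<Gamma>\<^esub> v) x = x" if x: "x \<in> supp p" for x
      using square_fixes_supp[OF p \<open>v \<in> _\<close> x] mult_IE[of v v x] supp_subset[of p] x \<open>v \<in> _\<close>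
      by (auto simp: centraliser_def)
    then show "supp w \<inter> supp (v \<otimes>\<^bsub>IE \<Gamma>\<^esub> v) = {}" using w(2) by (auto simp: supp_def)
  qed (rule w)
  then show "w \<in> rigid (IE \<Gamma>) p" using w by (auto simp: rigid_def centraliser_def)
qed

text \<open>If \<open>f\<close> moves a point \<open>x\<close> of \<open>supp p\<close>, a spin
  \<open>r\<close> on a small interval inside \<open>supp p\<close> displaced by \<open>f\<close>
  belongs to the rigid group; commuting with it would give \<open>f (r x) = f x\<close>.\<close>

lemma centraliser_rigid_iff:
  assumes p: "p \<in> carrier (IE \<Gamma>)" "p \<otimes>\<^bsub>IE \<Gamma>\<^esub> p = \<one>\<^bsub>IE \<Gamma>\<^esub>" and f: "f \<in> carrier (IE \<Gamma>)"
  shows "f \<in> centraliser (IE \<Gamma>) (rigid (IE \<Gamma>) p) \<longleftrightarrow> supp f \<inter> supp p = {}"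
proof
  assume "supp f \<inter> supp p = {}"
  then have "f \<otimes>\<^bsub>IE \<Gamma>\<^esub> w = w \<otimes>\<^bsub>IE \<Gamma>\<^esub> f" if "w \<in> rigid (IE \<Gamma>) p" for w
    using that by (intro commute_disjoint) (auto simp: rigid_eq[OF p] f)
  then show "f \<in> centraliser (IE \<Gamma>) (rigid (IE \<Gamma>) p)" using f by (simp add: centraliser_def)
next
  assume c: "f \<in> centraliser (IE \<Gamma>) (rigid (IE \<Gamma>) p)"
  have "x \<notin> supp p" if x: "x \<in> supp f" for x
  proof
    assume xp: "x \<in> supp p"
    obtain a b d where I: "a \<in> \<Gamma>" "b \<in> \<Gamma>" "0 \<le> a" "b \<le> 1" "x \<in> {a<..b}" "{a<..b} \<subseteq> {0<..1}"
      and off: "\<And>t. t \<in> {a<..b} \<Longrightarrow> f t \<notin> {a<..b}" and p': "\<And>t. t \<in> {a<..b} \<Longrightarrow> p t = t + d"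
      using moved_off[OF f p(1) x] by metis
    have "d \<noteq> 0" using p'[OF I(5)] xp by (auto simp: supp_def)
    then have "{a<..b} \<subseteq> supp p" using p' I(6) by (force simp: supp_def)
    have "a < b" using I(5) by simp
    then obtain r where r: "r \<in> carrier (IE \<Gamma>)" "supp r = {a<..b}"
      using spin[of a b] I by metis
    then have "r \<in> rigid (IE \<Gamma>) p" using \<open>{a<..b} \<subseteq> supp p\<close> by (simp add: rigid_eq[OF p])
    moreover have x01: "x \<in> {0<..1}" "f x \<in> {0<..1}" using I IE_in[OF f] by blast+
    ultimately have "f (r x) = r (f x)" using commuteD[OF c _ r(1)] by blast
    moreover have "r (f x) = f x" using not_supp[OF x01(2)] off[OF I(5)] r(2) by blast
    ultimately have "r x = x" using IE_inj[OF f IE_in[OF r(1) x01(1)] x01(1)] by simp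
    moreover have "x \<in> supp r" using r(2) I(5) by simp
    ultimately show False by (simp add: supp_def)
  qed
  then show "supp f \<inter> supp p = {}" by blast
qed

text \<open>The right side is stated in group operations alone, so isomorphisms respect it. It
  detects non-inclusion because a point moved by \<open>f\<close> and fixed by \<open>g\<close> has
  a small interval inside \<open>supp f\<close> and off \<open>supp g\<close>, which carries a
  nontrivial involution.\<close>

lemma supp_subset_iff:
  assumes f: "f \<in> carrier (IE \<Gamma>)" and g: "g \<in> carrier (IE \<Gamma>)"
  shows "supp f \<subseteq> supp g \<longleftrightarrow>
    (\<forall>p\<in>carrier (IE \<Gamma>). p \<otimes>\<^bsub>IE \<Gamma>\<^esub> p = \<one>\<^bsub>IE \<Gamma>\<^esub> \<longrightarrow> g \<in> centraliser (IE \<Gamma>) (rigid (IE \<Gamma>) p) \<longrightarrow>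
      f \<in> centraliser (IE \<Gamma>) (rigid (IE \<Gamma>) p))" (is "_ \<longleftrightarrow> ?R")
proof
  assume "supp f \<subseteq> supp g"
  then show ?R using centraliser_rigid_iff f g by blast
next
  assume R: ?R
  show "supp f \<subseteq> supp g"
  proof
    fix x assume x: "x \<in> supp f"
    show "x \<in> supp g"
    proof (rule ccontr)
      assume "x \<notin> supp g"
      then have gx: "g x = x" using x by (auto simp: supp_def)
      obtain a b d where I: "a \<in> \<Gamma>" "b \<in> \<Gamma>" "0 \<le> a" "b \<le> 1" "x \<in> {a<..b}" "{a<..b} \<subseteq> {0<..1}"
        and off: "\<And>t. t \<in> {a<..b} \<Longrightarrow> f t \<notin> {a<..b}" and g': "\<And>t. t \<in> {a<..b} \<Longrightarrow> g t = t + d"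
        using moved_off[OF f g x] by metis
      have "d = 0" using g'[OF I(5)] gx by simp
      then have "supp g \<inter> {a<..b} = {}" using g' by (auto simp: supp_def)
      moreover have "{a<..b} \<subseteq> supp f" using off I(6) by (force simp: supp_def)
      moreover have "a < b" using I(5) by simp
      then obtain r where "r \<in> carrier (IE \<Gamma>)" "supp r \<noteq> {}" "supp r \<subseteq> {a<..b}" "r \<otimes>\<^bsub>IE \<Gamma>\<^esub> r = \<one>\<^bsub>IE \<Gamma>\<^esub>"
        using involution_exists[of a b] I by metis
      ultimately show False using R centraliser_rigid_iff[of r] f g by blast
    qed
  qed
qed

section \<open>Covering, disjointness and conjugation of supports\<close>

text \<open>On a small interval \<open>g\<close> is a translation by one constant, so the interval
  lies either inside \<open>supp g\<close> or off it; \<open>r\<close> is a spin on it.\<close>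

lemma refine:
  assumes f: "f \<in> carrier (IE \<Gamma>)" and g: "g \<in> carrier (IE \<Gamma>)" and x: "x \<in> supp f"
  obtains r where "r \<in> carrier (IE \<Gamma>)" "x \<in> supp r" "supp r \<subseteq> supp f"
    "x \<in> supp g \<Longrightarrow> supp r \<subseteq> supp g" "x \<notin> supp g \<Longrightarrow> supp r \<inter> supp g = {}"
proof -
  obtain a b d where I: "a \<in> \<Gamma>" "b \<in> \<Gamma>" "0 \<le> a" "b \<le> 1" "x \<in> {a<..b}" "{a<..b} \<subseteq> {0<..1}"
    and off: "\<And>t. t \<in> {a<..b} \<Longrightarrow> f t \<notin> {a<..b}" and d: "\<And>t. t \<in> {a<..b} \<Longrightarrow> g t = t + d"
    using moved_off[OF f g x] by metis
  have "a < b" using I(5) by simp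
  then obtain r where r: "r \<in> carrier (IE \<Gamma>)" "supp r = {a<..b}"
    using spin[of a b] I by metis
  have g_iff: "t \<in> supp g \<longleftrightarrow> d \<noteq> 0" if "t \<in> {a<..b}" for t
    using d[OF that] I(6) that by (auto simp: supp_def)
  show ?thesis
  proof (rule that[OF r(1)])
    show "supp r \<subseteq> supp f" unfolding r(2) using off I(6) by (force simp: supp_def)
  qed (use r(2) I(5) g_iff in blast)+
qed

text \<open>Supports of group elements suffice as test sets. An uncovered point is isolated by
  refining twice, first away from \<open>supp g\<close>, then away from
  \<open>supp h\<close>.\<close>

lemma supp_covered_iff:
  assumes "f \<in> carrier (IE \<Gamma>)" "g \<in> carrier (IE \<Gamma>)" "h \<in> carrier (IE \<Gamma>)"
  shows "supp f \<subseteq> supp g \<union> supp h \<longleftrightarrow>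
    (\<forall>r\<in>carrier (IE \<Gamma>). supp r \<subseteq> supp f \<longrightarrow> supp r \<inter> supp g = {} \<longrightarrow> supp r \<inter> supp h = {} \<longrightarrow> supp r = {})"
    (is "_ \<longleftrightarrow> ?R")
proof
  assume R: ?R
  show "supp f \<subseteq> supp g \<union> supp h"
  proof
    fix x assume x: "x \<in> supp f"
    show "x \<in> supp g \<union> supp h"
    proof (rule ccontr)
      assume n: "x \<notin> supp g \<union> supp h"
      obtain r where r: "r \<in> carrier (IE \<Gamma>)" "x \<in> supp r" "supp r \<subseteq> supp f" "supp r \<inter> supp g = {}"
        using refine[OF assms(1,2) x] n by (metis UnI1)
      obtain s where "s \<in> carrier (IE \<Gamma>)" "x \<in> supp s" "supp s \<subseteq> supp r" "supp s \<inter> supp h = {}"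
        using refine[OF r(1) assms(3) r(2)] n by (metis UnI2)
      then show False using R r by blast
    qed
  qed
qed blast

lemma supp_disjoint_iff:
  assumes "f \<in> carrier (IE \<Gamma>)" "g \<in> carrier (IE \<Gamma>)"
  shows "supp f \<inter> supp g = {} \<longleftrightarrow>
    (\<forall>r\<in>carrier (IE \<Gamma>). supp r \<subseteq> supp f \<longrightarrow> supp r \<subseteq> supp g \<longrightarrow> r = \<one>\<^bsub>IE \<Gamma>\<^esub>)" (is "_ \<longleftrightarrow> ?R")
proof
  assume "supp f \<inter> supp g = {}"
  then show ?R using supp_empty by blast
next
  assume R: ?R
  have "x \<notin> supp g" if x: "x \<in> supp f" for x
  proof
    assume "x \<in> supp g"
    then obtain r where r: "r \<in> carrier (IE \<Gamma>)" "x \<in> supp r" "supp r \<subseteq> supp f" "supp r \<subseteq> supp g"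
      using refine[OF assms x] by metis
    then have "r = \<one>\<^bsub>IE \<Gamma>\<^esub>" using R by blast
    then show False using r(2) by (auto simp: supp_def)
  qed
  then show "supp f \<inter> supp g = {}" by blast
qed

lemma supp_conj:
  assumes "f \<in> carrier (IE \<Gamma>)" "g \<in> carrier (IE \<Gamma>)"
  shows "supp (g \<otimes>\<^bsub>IE \<Gamma>\<^esub> f \<otimes>\<^bsub>IE \<Gamma>\<^esub> inv\<^bsub>IE \<Gamma>\<^esub> g) = g ` supp f"
proof -
  have conj: "(g \<otimes>\<^bsub>IE \<Gamma>\<^esub> f \<otimes>\<^bsub>IE \<Gamma>\<^esub> inv\<^bsub>IE \<Gamma>\<^esub> g) (g y) = g (f y)" if "y \<in> {0<..1}" for y
    using assms IE_in[OF assms(2) that] that by (simp del: greaterThanAtMost_iff)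
  show ?thesis
  proof (intro equalityI subsetI)
    fix x assume x: "x \<in> supp (g \<otimes>\<^bsub>IE \<Gamma>\<^esub> f \<otimes>\<^bsub>IE \<Gamma>\<^esub> inv\<^bsub>IE \<Gamma>\<^esub> g)"
    then have "x \<in> g ` {0<..1}"
      using bij_IE[OF assms(2)] by (simp add: supp_def bij_betw_def)
    then obtain y where y: "x = g y" "y \<in> {0<..1}" by (rule imageE)
    then have "f y \<noteq> y" using x conj[OF y(2)] by (auto simp: supp_def)
    then show "x \<in> g ` supp f" using y by (simp add: supp_def)
  next
    fix x assume "x \<in> g ` supp f"
    then obtain y where y: "x = g y" "y \<in> {0<..1}" "f y \<noteq> y" by (auto simp: supp_def)
    then have "g (f y) \<noteq> g y" using IE_inj[OF assms(2) IE_in[OF assms(1)]] by blast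
    then show "x \<in> supp (g \<otimes>\<^bsub>IE \<Gamma>\<^esub> f \<otimes>\<^bsub>IE \<Gamma>\<^esub> inv\<^bsub>IE \<Gamma>\<^esub> g)"
      using y(1) conj[OF y(2)] IE_in[OF assms(2) y(2)] by (simp add: supp_def)
  qed
qed

section \<open>Measure of supports\<close>

text \<open>Disjoint pieces, as additivity of the measure requires; the cover in
  \<open>piecewise\<close> may overlap.\<close>

lemma partition:
  assumes "f \<in> carrier (IE \<Gamma>)"
  obtains I :: "nat set" and l u c :: "nat \<Rightarrow> real" where "finite I" "disjoint_family_on (\<lambda>i. {l i<..u i}) I"
    "(\<Union>i\<in>I. {l i<..u i}) = {0<..1}" "\<forall>i\<in>I. l i \<in> \<Gamma> \<and> u i \<in> \<Gamma> \<and> l i \<le> u i"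
    "\<forall>i\<in>I. \<forall>t\<in>{l i<..u i}. f t = t + c i"
proof -
  obtain n :: nat and x c :: "nat \<Rightarrow> real" where x: "2 \<le> n" "x 1 = 0" "x n = 1"
    "\<And>i. i \<in> {1..n} \<Longrightarrow> x i \<in> \<Gamma>" "\<And>i. i \<in> {1..<n} \<Longrightarrow> x i < x (Suc i)"
    "\<And>i. i \<in> {1..<n} \<Longrightarrow> c i \<in> \<Gamma>" "\<And>i t. i \<in> {1..<n} \<Longrightarrow> t \<in> {x i<..x (Suc i)} \<Longrightarrow> f t = t + c i"
    using steps[OF piecewise_IE[OF assms]] by metis
  have mono: "x i \<le> x j" if "i \<le> j" "1 \<le> i" "j \<le> n" for i j
    using that
  proof (induction j rule: dec_induct)
    case base
    then show ?case by simp
  next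
    case (step m)
    then show ?case using x(5)[of m] by auto
  qed
  have "disjoint_family_on (\<lambda>i. {x i<..x (Suc i)}) {1..<n}"
    unfolding disjoint_family_on_def
  proof (intro ballI impI)
    fix i j assume "i \<in> {1..<n}" "j \<in> {1..<n}" "i \<noteq> j"
    then show "{x i<..x (Suc i)} \<inter> {x j<..x (Suc j)} = {}"
      using mono[of "Suc i" j] mono[of "Suc j" i] by (cases "i < j") auto
  qed
  moreover have "(\<Union>i\<in>{1..<n}. {x i<..x (Suc i)}) = {0<..1}"
  proof (intro equalityI subsetI)
    fix t assume "t \<in> (\<Union>i\<in>{1..<n}. {x i<..x (Suc i)})"
    then obtain i where "i \<in> {1..<n}" "t \<in> {x i<..x (Suc i)}" by blast
    then show "t \<in> {0<..1}" using mono[of 1 i] mono[of "Suc i" n] x(2,3) by auto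
  next
    fix t :: real assume "t \<in> {0<..1}"
    then obtain i where "i \<in> {1..<n}" "x i < t" "t \<le> x (Suc i)"
      using in_step[of n x t] x by auto
    then show "t \<in> (\<Union>i\<in>{1..<n}. {x i<..x (Suc i)})" by auto
  qed
  ultimately show ?thesis
    using x(4,7) less_imp_le[OF x(5)] by (intro that[of "{1..<n}" x "\<lambda>i. x (Suc i)" c]) auto
qed

text \<open>The support is the union of the pieces with nonzero offset, so its measure is a finite
  sum of differences of endpoints in \<open>\<Gamma>\<close>.\<close>

lemma supp_measure:
  assumes "f \<in> carrier (IE \<Gamma>)"
  shows "supp f \<in> lmeasurable" "measure lebesgue (supp f) \<in> \<Gamma>"
proof -
  obtain I :: "nat set" and l u c :: "nat \<Rightarrow> real" where I: "finite I" "disjoint_family_on (\<lambda>i. {l i<..u i}) I"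
    "(\<Union>i\<in>I. {l i<..u i}) = {0<..1}" "\<forall>i\<in>I. l i \<in> \<Gamma> \<and> u i \<in> \<Gamma> \<and> l i \<le> u i"
    and "\<forall>i\<in>I. \<forall>t\<in>{l i<..u i}. f t = t + c i"
    using partition[OF assms] by blast
  then have c: "f t = t + c i" if "i \<in> I" "t \<in> {l i<..u i}" for i t
    using that by blast
  define J where "J = {i \<in> I. c i \<noteq> 0}"
  have J: "finite J" "J \<subseteq> I" using I by (auto simp: J_def)
  have eq: "supp f = (\<Union>i\<in>J. {l i<..u i})"
  proof (intro equalityI subsetI)
    fix t assume "t \<in> supp f"
    then have "t \<in> (\<Union>i\<in>I. {l i<..u i})" "f t \<noteq> t" unfolding I(3) by (auto simp: supp_def)
    then obtain i where "i \<in> I" "t \<in> {l i<..u i}" "f t \<noteq> t" by blast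
    then show "t \<in> (\<Union>i\<in>J. {l i<..u i})" using c[of i t] by (auto simp: J_def)
  next
    fix t assume "t \<in> (\<Union>i\<in>J. {l i<..u i})"
    then obtain i where i: "i \<in> I" "c i \<noteq> 0" "t \<in> {l i<..u i}" by (auto simp: J_def)
    then have "t \<in> {0<..1}" unfolding I(3)[symmetric] by blast
    then show "t \<in> supp f" using c[OF i(1,3)] i(2) by (simp add: supp_def)
  qed
  show "supp f \<in> lmeasurable"
    unfolding eq using J by (intro fmeasurable.finite_UN half_open_lmeasurable)
  have "measure lebesgue (supp f) = (\<Sum>i\<in>J. measure lebesgue {l i<..u i})"
    unfolding eq
    by (rule measure_finite_Union_fmeasurable[OF J(1) half_open_lmeasurable
          disjoint_family_on_mono[OF J(2) I(2)]])
  also have "\<dots> = (\<Sum>i\<in>J. u i - l i)"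
    using I(4) J by (intro sum.cong) auto
  also have "\<dots> \<in> \<Gamma>" using I(4) J by (intro sum_mem diff) auto
  finally show "measure lebesgue (supp f) \<in> \<Gamma>" .
qed

text \<open>Cut \<open>S\<close> along the pieces of \<open>f\<close>: each part is translated, and
  the images stay disjoint by injectivity.\<close>

lemma measure_image:
  assumes f: "f \<in> carrier (IE \<Gamma>)" and S: "S \<in> lmeasurable" "S \<subseteq> {0<..1}"
  shows "measure lebesgue (f ` S) = measure lebesgue S"
proof -
  obtain I :: "nat set" and l u c :: "nat \<Rightarrow> real" where I: "finite I" "disjoint_family_on (\<lambda>i. {l i<..u i}) I"
    "(\<Union>i\<in>I. {l i<..u i}) = {0<..1}" "\<forall>i\<in>I. l i \<in> \<Gamma> \<and> u i \<in> \<Gamma> \<and> l i \<le> u i"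
    and "\<forall>i\<in>I. \<forall>t\<in>{l i<..u i}. f t = t + c i"
    using partition[OF f] by blast
  then have c: "f t = t + c i" if "i \<in> I" "t \<in> {l i<..u i}" for i t
    using that by blast
  define P where "P i = S \<inter> {l i<..u i}" for i
  have P: "P i \<in> lmeasurable" "P i \<subseteq> {0<..1}" for i
  proof -
    show "P i \<in> lmeasurable" unfolding P_def by (intro fmeasurable.Int S(1) half_open_lmeasurable)
    show "P i \<subseteq> {0<..1}" using S(2) unfolding P_def by blast
  qed
  have disj: "disjoint_family_on P I"
    using I(2) unfolding disjoint_family_on_def P_def by blast
  have SP: "S = (\<Union>i\<in>I. P i)" using S(2) I(3) by (auto simp: P_def)
  have img: "f ` P i = (+) (c i) ` P i" if "i \<in> I" for i
    using c[OF that] unfolding P_def by (intro image_cong refl) (simp add: add.commute)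
  have img_meas: "f ` P i \<in> lmeasurable" if "i \<in> I" for i
    unfolding img[OF that] by (intro measurable_translation P)
  have inj: "inj_on f {0<..1}" using bij_IE[OF f] by (simp add: bij_betw_def)
  have "f ` P i \<inter> f ` P j = {}" if "i \<in> I" "j \<in> I" "i \<noteq> j" for i j
  proof -
    have "P i \<inter> P j = {}" using disj that by (simp add: disjoint_family_on_def)
    then show ?thesis using inj_on_image_Int[OF inj P(2) P(2), of i j] by simp
  qed
  then have disj': "disjoint_family_on (\<lambda>i. f ` P i) I"
    by (simp add: disjoint_family_on_def)
  have "measure lebesgue (f ` S) = measure lebesgue (\<Union>i\<in>I. f ` P i)"
    using SP by (simp add: image_UN)
  also have "\<dots> = (\<Sum>i\<in>I. measure lebesgue (f ` P i))"
    by (rule measure_finite_Union_fmeasurable[OF I(1) img_meas disj'])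
  also have "\<dots> = (\<Sum>i\<in>I. measure lebesgue (P i))"
    by (intro sum.cong refl) (simp add: img measure_translation)
  also have "\<dots> = measure lebesgue (\<Union>i\<in>I. P i)"
    by (rule measure_finite_Union_fmeasurable[OF I(1) P(1) disj, symmetric])
  finally show ?thesis using SP by simp
qed

section \<open>Vanishing of bounded additive functions\<close>

text \<open>Since \<open>e 1 = 0\<close>, composing \<open>e\<close> with \<open>frac\<close> gives
  an additive function on all of \<open>\<Gamma>\<close>, still bounded by 1. Its value at
  \<open>n * t\<close> is \<open>n * e t\<close>, so a nonzero \<open>e t\<close> would break the
  bound.\<close>

lemma additive_bounded_zero:
  assumes additive: "\<And>s t. s \<in> \<Gamma> \<Longrightarrow> t \<in> \<Gamma> \<Longrightarrow> 0 \<le> s \<Longrightarrow> 0 \<le> t \<Longrightarrow> s + t \<le> 1 \<Longrightarrow> e (s + t) = e s + (e t :: real)"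
    and bound: "\<And>t. t \<in> \<Gamma> \<Longrightarrow> 0 \<le> t \<Longrightarrow> t \<le> 1 \<Longrightarrow> \<bar>e t\<bar> \<le> 1" and e1: "e 1 = 0"
    and t: "t \<in> \<Gamma>" "0 \<le> t" "t \<le> 1"
  shows "e t = 0"
proof (cases "t = 1")
  case False
  have frac_mem: "frac x \<in> \<Gamma>" if "x \<in> \<Gamma>" for x
    using diff[OF that of_int_mem] by (simp add: frac_def)
  have e_frac_add: "e (frac (x + y)) = e (frac x) + e (frac y)" if xy: "x \<in> \<Gamma>" "y \<in> \<Gamma>" for x y
  proof (cases "frac x + frac y < 1")
    case True
    then show ?thesis using additive[OF frac_mem[OF xy(1)] frac_mem[OF xy(2)]] by (simp add: frac_add)
  next
    case False
    \<comment> \<open>In the carry case, comparing the decompositions of \<open>frac x\<close> as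
      \<open>z + (1 - frac y)\<close> and of 1 as \<open>(1 - frac y) + frac y\<close> eliminates
      \<open>e (1 - frac y)\<close>.\<close>
    define z where "z = frac x + frac y - 1"
    have z: "z \<in> \<Gamma>" "0 \<le> z"
      using diff[OF add[OF frac_mem[OF xy(1)] frac_mem[OF xy(2)]] one] False by (simp_all add: z_def)
    have y': "1 - frac y \<in> \<Gamma>" "0 \<le> 1 - frac y"
      using xy frac_lt_1[of y] by (auto simp: frac_mem one intro!: diff less_imp_le)
    have "e (z + (1 - frac y)) = e z + e (1 - frac y)"
      using frac_lt_1[of x] by (intro additive z y') (simp add: z_def)
    moreover have "z + (1 - frac y) = frac x" by (simp add: z_def)
    moreover have "e ((1 - frac y) + frac y) = e (1 - frac y) + e (frac y)"
      by (intro additive y' frac_mem xy) auto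
    ultimately have "e z = e (frac x) + e (frac y)" using e1 by simp
    then show ?thesis using False by (simp add: frac_add z_def)
  qed
  have multiple: "e (frac (of_nat n * t)) = of_nat n * e (frac t)" for n
  proof (induction n)
    case 0
    then show ?case using additive[of 0 0] by (simp add: zero)
  next
    case (Suc n)
    then show ?case
      using e_frac_add[OF t(1) of_nat_mult[OF t(1)], of n] by (simp add: algebra_simps)
  qed
  \<comment> \<open>The endpoint 1 was split off because \<open>frac 1 = 0\<close>; there the claim
    is the hypothesis on \<open>e 1\<close>.\<close>
  have "frac t = t" using False t by (simp add: frac_eq)
  have le: "of_nat n * \<bar>e t\<bar> \<le> 1" for n
    using bound[OF frac_mem[OF of_nat_mult[OF t(1)]], of n] multiple[of n] \<open>frac t = t\<close> frac_lt_1[of "of_nat n * t"]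
    by (simp add: abs_mult)
  show ?thesis
  proof (rule ccontr)
    assume "e t \<noteq> 0"
    then obtain n where "1 < of_nat n * \<bar>e t\<bar>" using reals_Archimedean3[of "\<bar>e t\<bar>"] by auto
    then show False using le[of n] by simp
  qed
qed (simp add: e1)

end

section \<open>The mass induced by an isomorphism\<close>

locale IE_isomorphism = A: dense_subgroup \<Gamma> + B: dense_subgroup \<Gamma>' for \<Gamma> \<Gamma>' +
  fixes \<phi> :: "(real \<Rightarrow> real) \<Rightarrow> real \<Rightarrow> real"
  assumes \<phi>: "\<phi> \<in> iso (IE \<Gamma>) (IE \<Gamma>')"
begin

sublocale group_hom "IE \<Gamma>" "IE \<Gamma>'" \<phi>
  using \<phi> by unfold_locales (simp add: iso_def)

section \<open>Transfer of support relations along the isomorphism\<close>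

lemma ball_carrier: "(\<forall>y\<in>carrier (IE \<Gamma>'). P y) \<longleftrightarrow> (\<forall>x\<in>carrier (IE \<Gamma>). P (\<phi> x))"
proof -
  have "carrier (IE \<Gamma>') = \<phi> ` carrier (IE \<Gamma>)" using \<phi> by (auto simp: iso_iff)
  then show ?thesis by simp
qed

lemma eq_one_iff: "x \<in> carrier (IE \<Gamma>) \<Longrightarrow> \<phi> x = \<one>\<^bsub>IE \<Gamma>'\<^esub> \<longleftrightarrow> x = \<one>\<^bsub>IE \<Gamma>\<^esub>"
  using \<phi> by (metis (no_types) A.G.one_closed hom_one iso_iff inj_on_eq_iff)

lemma rigid_centraliser_iff:
  assumes "f \<in> carrier (IE \<Gamma>)" "p \<in> carrier (IE \<Gamma>)"
  shows "\<phi> f \<in> centraliser (IE \<Gamma>') (rigid (IE \<Gamma>') (\<phi> p)) \<longleftrightarrow> f \<in> centraliser (IE \<Gamma>) (rigid (IE \<Gamma>) p)"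
proof -
  have "rigid (IE \<Gamma>) p \<subseteq> carrier (IE \<Gamma>)" by (auto simp: rigid_def centraliser_def)
  from centraliser_iso[OF \<phi> this assms(1) A.G.group_axioms B.G.group_axioms] show ?thesis
    by (simp add: rigid_iso[OF \<phi> assms(2) A.G.group_axioms B.G.group_axioms])
qed

lemma supp_subset_transfer:
  assumes "f \<in> carrier (IE \<Gamma>)" "g \<in> carrier (IE \<Gamma>)"
  shows "supp (\<phi> f) \<subseteq> supp (\<phi> g) \<longleftrightarrow> supp f \<subseteq> supp g"
  unfolding A.supp_subset_iff[OF assms] B.supp_subset_iff[OF hom_closed[OF assms(1)] hom_closed[OF assms(2)]]
    ball_carrier
  by (intro ball_cong refl)
    (simp add: rigid_centraliser_iff assms eq_one_iff flip: hom_mult)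

lemma supp_disjoint_transfer:
  assumes "f \<in> carrier (IE \<Gamma>)" "g \<in> carrier (IE \<Gamma>)"
  shows "supp (\<phi> f) \<inter> supp (\<phi> g) = {} \<longleftrightarrow> supp f \<inter> supp g = {}"
  unfolding A.supp_disjoint_iff[OF assms] B.supp_disjoint_iff[OF hom_closed[OF assms(1)] hom_closed[OF assms(2)]]
    ball_carrier
  by (intro ball_cong refl) (simp add: supp_subset_transfer assms eq_one_iff)

lemma supp_empty_transfer:
  assumes "f \<in> carrier (IE \<Gamma>)"
  shows "supp (\<phi> f) = {} \<longleftrightarrow> supp f = {}"
  using supp_disjoint_transfer[OF assms assms] by simp

lemma supp_covered_transfer:
  assumes "f \<in> carrier (IE \<Gamma>)" "g \<in> carrier (IE \<Gamma>)" "h \<in> carrier (IE \<Gamma>)"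
  shows "supp (\<phi> f) \<subseteq> supp (\<phi> g) \<union> supp (\<phi> h) \<longleftrightarrow> supp f \<subseteq> supp g \<union> supp h"
  unfolding A.supp_covered_iff[OF assms]
    B.supp_covered_iff[OF hom_closed[OF assms(1)] hom_closed[OF assms(2)] hom_closed[OF assms(3)]] ball_carrier
  by (intro ball_cong refl)
    (simp add: supp_subset_transfer supp_disjoint_transfer supp_empty_transfer assms)

section \<open>The mass of an interval and its invariance\<close>

text \<open>The choice is immaterial for \<open>mass\<close>: by
  \<open>supp_subset_transfer\<close>, elements with equal supports have images with equal
  supports.\<close>

definition spinner :: "real \<Rightarrow> real \<Rightarrow> real \<Rightarrow> real"
  where "spinner a b = (SOME r. r \<in> carrier (IE \<Gamma>) \<and> supp r = {a<..b})"

definition mass :: "real \<Rightarrow> real \<Rightarrow> real"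
  where "mass a b = measure lebesgue (supp (\<phi> (spinner a b)))"

lemma spinner:
  assumes "a \<in> \<Gamma>" "b \<in> \<Gamma>" "0 \<le> a" "a < b" "b \<le> 1"
  shows "spinner a b \<in> carrier (IE \<Gamma>)" "supp (spinner a b) = {a<..b}"
proof -
  have "\<exists>r. r \<in> carrier (IE \<Gamma>) \<and> supp r = {a<..b}" using A.spin[OF assms] by metis
  from someI_ex[OF this] show "spinner a b \<in> carrier (IE \<Gamma>)" "supp (spinner a b) = {a<..b}"
    by (auto simp: spinner_def)
qed

lemma mass_add:
  assumes "a \<in> \<Gamma>" "b \<in> \<Gamma>" "c \<in> \<Gamma>" "0 \<le> a" "a < b" "b < c" "c \<le> 1"
  shows "mass a c = mass a b + mass b c"
proof -
  have ab: "spinner a b \<in> carrier (IE \<Gamma>)" "supp (spinner a b) = {a<..b}"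
    and bc: "spinner b c \<in> carrier (IE \<Gamma>)" "supp (spinner b c) = {b<..c}"
    and ac: "spinner a c \<in> carrier (IE \<Gamma>)" "supp (spinner a c) = {a<..c}"
    using spinner[of a b] spinner[of b c] spinner[of a c] assms by simp_all
  have disj: "supp (\<phi> (spinner a b)) \<inter> supp (\<phi> (spinner b c)) = {}"
    unfolding supp_disjoint_transfer[OF ab(1) bc(1)] by (auto simp: ab bc)
  have "supp (\<phi> (spinner a c)) \<subseteq> supp (\<phi> (spinner a b)) \<union> supp (\<phi> (spinner b c))"
    unfolding supp_covered_transfer[OF ac(1) ab(1) bc(1)] by (auto simp: ab bc ac)
  moreover have "supp (\<phi> (spinner a b)) \<subseteq> supp (\<phi> (spinner a c))"
    unfolding supp_subset_transfer[OF ab(1) ac(1)] using assms by (auto simp: ab ac)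
  moreover have "supp (\<phi> (spinner b c)) \<subseteq> supp (\<phi> (spinner a c))"
    unfolding supp_subset_transfer[OF bc(1) ac(1)] using assms by (auto simp: bc ac)
  ultimately have "supp (\<phi> (spinner a c)) = supp (\<phi> (spinner a b)) \<union> supp (\<phi> (spinner b c))"
    by blast
  then show ?thesis
    using B.supp_measure(1)[OF hom_closed[OF ab(1)]] B.supp_measure(1)[OF hom_closed[OF bc(1)]] disj
    by (simp add: mass_def measure_Un3)
qed

text \<open>Conjugation by a \<open>g\<close> that carries (a, b] to its translate becomes
  conjugation by \<open>\<phi> g\<close>, which moves the image support by a measure preserving
  map.\<close>

lemma mass_translate:
  assumes "a \<in> \<Gamma>" "b \<in> \<Gamma>" "d \<in> \<Gamma>" "0 \<le> a" "a < b" "0 < d" "b + d \<le> 1"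
  shows "mass (a + d) (b + d) = mass a b"
proof -
  have "b + d \<in> \<Gamma>" "d < b + d - a" using assms A.add by auto
  then obtain g where g: "g \<in> carrier (IE \<Gamma>)" "\<And>x. x \<in> {a<..b + d - d} \<Longrightarrow> g x = x + d"
    using A.rotation[of a "b + d" d] assms by metis
  have r: "spinner a b \<in> carrier (IE \<Gamma>)" "supp (spinner a b) = {a<..b}"
    and r': "spinner (a + d) (b + d) \<in> carrier (IE \<Gamma>)" "supp (spinner (a + d) (b + d)) = {a + d<..b + d}"
    using spinner[of a b] spinner[of "a + d" "b + d"] assms A.add by simp_all
  have "g ` {a<..b} = (\<lambda>x. x + d) ` {a<..b}" using g(2) by (intro image_cong) auto
  also have "\<dots> = {a + d<..b + d}" by (auto intro!: image_eqI[where x = "x - d" for x])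
  finally have conj_supp: "supp (g \<otimes>\<^bsub>IE \<Gamma>\<^esub> spinner a b \<otimes>\<^bsub>IE \<Gamma>\<^esub> inv\<^bsub>IE \<Gamma>\<^esub> g) = supp (spinner (a + d) (b + d))"
    using A.supp_conj[OF r(1) g(1)] r r' by simp
  have conj: "g \<otimes>\<^bsub>IE \<Gamma>\<^esub> spinner a b \<otimes>\<^bsub>IE \<Gamma>\<^esub> inv\<^bsub>IE \<Gamma>\<^esub> g \<in> carrier (IE \<Gamma>)"
    using r(1) g(1) by simp
  have "supp (\<phi> (spinner (a + d) (b + d))) = supp (\<phi> (g \<otimes>\<^bsub>IE \<Gamma>\<^esub> spinner a b \<otimes>\<^bsub>IE \<Gamma>\<^esub> inv\<^bsub>IE \<Gamma>\<^esub> g))"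
    using supp_subset_transfer[OF r'(1) conj] supp_subset_transfer[OF conj r'(1)] conj_supp by simp
  also have "\<dots> = \<phi> g ` supp (\<phi> (spinner a b))"
    using B.supp_conj[of "\<phi> (spinner a b)" "\<phi> g"] r(1) g(1) by simp
  finally show ?thesis
    using B.measure_image[of "\<phi> g" "supp (\<phi> (spinner a b))"] B.supp_measure(1) r(1) g(1) supp_subset
    by (simp add: mass_def)
qed

text \<open>By surjectivity some \<open>\<phi> x\<close> has full support; since
  \<open>supp x\<close> lies in (0, 1], the image of the spinner on (0, 1] has full support
  too.\<close>

lemma mass_total: "mass 0 1 = 1"
proof -
  have r: "spinner 0 1 \<in> carrier (IE \<Gamma>)" "supp (spinner 0 1) = {0<..1}"
    using spinner[of 0 1] A.zero A.one by simp_all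
  obtain s where s: "s \<in> carrier (IE \<Gamma>')" "supp s = {0<..1}"
    using B.spin[OF B.zero B.one order_refl zero_less_one order_refl] by metis
  then obtain x where x: "x \<in> carrier (IE \<Gamma>)" "s = \<phi> x"
    using \<phi> by (auto simp: iso_iff)
  have "supp (\<phi> x) \<subseteq> supp (\<phi> (spinner 0 1))"
    unfolding supp_subset_transfer[OF x(1) r(1)] r(2) by (rule supp_subset)
  then have "supp (\<phi> (spinner 0 1)) = {0<..1}"
    using s x supp_subset by blast
  then show ?thesis by (simp add: mass_def)
qed

lemma mass_eq:
  assumes "t \<in> \<Gamma>" "0 < t" "t \<le> 1"
  shows "mass 0 t = t"
proof -
  \<comment> \<open>The deviation of the mass from the length. Its value at 0 is set by hand, as the
    facts about \<open>mass\<close> concern nondegenerate intervals.\<close>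
  define e where "e s = (if s = 0 then 0 else mass 0 s - s)" for s
  have "e t = 0"
  proof (rule A.additive_bounded_zero[of e])
    show "e (s + t) = e s + e t" if "s \<in> \<Gamma>" "t \<in> \<Gamma>" "0 \<le> s" "0 \<le> t" "s + t \<le> 1" for s t
    proof (cases "s = 0 \<or> t = 0")
      case False
      then have "mass 0 (s + t) = mass 0 s + mass s (s + t)"
        using that by (intro mass_add) (auto simp: A.zero A.add)
      also have "mass s (s + t) = mass 0 t"
        using mass_translate[of 0 t s] that False A.zero by (simp add: add.commute)
      finally show ?thesis using False that by (simp add: e_def)
    qed (auto simp: e_def)
    show "\<bar>e s\<bar> \<le> 1" if s: "s \<in> \<Gamma>" "0 \<le> s" "s \<le> 1" for s
    proof -
      have "mass 0 s \<le> 1" if "0 < s"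
      proof (cases "s = 1")
        case False
        then have "1 = mass 0 s + mass s 1"
          using mass_add[of 0 s 1] s that A.zero A.one mass_total by simp
        moreover have "0 \<le> mass s 1" by (simp add: mass_def)
        ultimately show ?thesis by simp
      qed (simp add: mass_total)
      moreover have "0 \<le> mass 0 s" by (simp add: mass_def)
      ultimately show ?thesis using s by (auto simp: e_def)
    qed
  qed (use assms in \<open>auto simp: e_def mass_total\<close>)
  then show ?thesis using assms by (simp add: e_def)
qed

text \<open>A fractional part is the mass of an interval, thus the measure of a support in
  \<open>IE \<Gamma>'\<close>, and such measures lie in \<open>\<Gamma>'\<close>; the integer part
  lies there because 1 does.\<close>

lemma subset: "\<Gamma> \<subseteq> \<Gamma>'"
proof
  fix x assume x: "x \<in> \<Gamma>"
  have "frac x \<in> \<Gamma>'"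
  proof (cases "frac x = 0")
    case True
    show ?thesis unfolding True by (rule B.zero)
  next
    case False
    have f: "frac x \<in> \<Gamma>" using A.diff[OF x A.of_int_mem] by (simp add: frac_def)
    have "0 < frac x" "frac x \<le> 1" using False frac_ge_0[of x] frac_lt_1[of x] by linarith+
    then have "mass 0 (frac x) = frac x" using mass_eq f by blast
    then show ?thesis
      using B.supp_measure(2)[OF hom_closed[OF spinner(1)[of 0 "frac x"]]] \<open>0 < frac x\<close> \<open>frac x \<le> 1\<close> f A.zero
      by (simp add: mass_def)
  qed
  then show "x \<in> \<Gamma>'" using B.add[OF B.of_int_mem[of "\<lfloor>x\<rfloor>"], of "frac x"] by (simp add: frac_def)
qed

end

lemma IE_iso_subset:
  assumes "dense_subgroup \<Gamma>" "dense_subgroup \<Gamma>'" "IE \<Gamma> \<cong> IE \<Gamma>'"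
  shows "\<Gamma> \<subseteq> \<Gamma>'"
proof -
  obtain \<phi> where "\<phi> \<in> iso (IE \<Gamma>) (IE \<Gamma>')" using assms(3) by (auto simp: is_iso_def)
  then have "IE_isomorphism \<Gamma> \<Gamma>' \<phi>"
    using assms by (simp add: IE_isomorphism_def IE_isomorphism_axioms_def)
  then show ?thesis by (rule IE_isomorphism.subset)
qed

theorem theorem5:
  fixes \<Gamma> \<Gamma>' :: "real set"
  assumes "subgroup \<Gamma> real_add_group" and "countable \<Gamma>" and "closure \<Gamma> = UNIV" and "1 \<in> \<Gamma>"
    and "subgroup \<Gamma>' real_add_group" and "countable \<Gamma>'" and "closure \<Gamma>' = UNIV" and "1 \<in> \<Gamma>'"
  shows "IE \<Gamma> \<cong> IE \<Gamma>' \<longleftrightarrow> \<Gamma> = \<Gamma>'"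
proof
  assume iso: "IE \<Gamma> \<cong> IE \<Gamma>'"
  interpret A: dense_subgroup \<Gamma> using assms by (simp add: dense_subgroup_def)
  interpret B: dense_subgroup \<Gamma>' using assms by (simp add: dense_subgroup_def)
  show "\<Gamma> = \<Gamma>'"
    using IE_iso_subset[OF A.dense_subgroup_axioms B.dense_subgroup_axioms iso]
      IE_iso_subset[OF B.dense_subgroup_axioms A.dense_subgroup_axioms A.G.iso_sym[OF iso]] by blast
qed (simp add: iso_refl)

end
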